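(* Let $A$ be a $C^*$-algebra. If $A$ has the Hjelmborg-Rørdam property, then $A$ has property (S). If $A$ has property (S), then $A$ is soft.
   Context: For a $C^*$-algebra $A$ let $A_c:=\{a\in A_+:a=ab\text{ for some }b\in A_+\}$. For $a,b\in A_+$ write $a\perp b$ if $ab=0$. $A$ has the Hjelmborg-Rørdam property if for every $a\in A_c$ there exists $b\in A_+$ such that $a\perp b$ and such that $a=x^*x$ and $b=xx^*$ for some $x\in A$. Cuntz semigroup: for positive elements $a,b$ in a $C^*$-algebra $B$, write $a\precsim b$ if there is a sequence $(r_n)_n$ in $B$ with $a=\lim_n r_nbr_n^*$, and $a\sim b$ if $a\precsim b\precsim a$. With $\mathbb{K}$ the compact operators on a separable infinite-dimensional Hilbert space, $\mathrm{Cu}(A):=(A\otimes\mathbb{K})_+/\!\sim$, with order induced by $\precsim$ and addition induced by addition of orthogonal elements; $[a]$ is the class of $a$, and $A$ is viewed as a corner $A\otimes e_{11}\subseteq A\otimes\mathbb{K}$. Write $[a]<_s[b]$ if $(n+1)[a]\leq n[b]$ in $\mathrm{Cu}(A)$ for some $n\in\mathbb{N}$. $A$ has property (S) if for every $a\in A_c$ there exists $b\in A_+$ such that $a\perp b$ and $[a]<_s[b]$ in $\mathrm{Cu}(A)$. $A$ is soft if for every proper closed two-sided ideal $I\subseteq A$ the quotient $A/I$ is nonunital. *)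

theory Defs
  imports "HOL-Analysis.Analysis"
begin

section \<open>C*-algebras\<close>

text \<open>Complex C*-algebras, not necessarily unital; the zero algebra is allowed.\<close>

class cstar_algebra = real_normed_algebra + banach +
  fixes scaleC :: "complex \<Rightarrow> 'a \<Rightarrow> 'a"  (infixr \<open>*\<^sub>C\<close> 75)
    and star :: "'a \<Rightarrow> 'a"
  assumes scaleC_add_right: "c *\<^sub>C (x + y) = c *\<^sub>C x + c *\<^sub>C y"
    and scaleC_add_left: "(c + d) *\<^sub>C x = c *\<^sub>C x + d *\<^sub>C x"
    and scaleC_scaleC: "c *\<^sub>C d *\<^sub>C x = (c * d) *\<^sub>C x"
    and scaleR_eq_scaleC: "r *\<^sub>R x = complex_of_real r *\<^sub>C x"
    and norm_scaleC: "norm (c *\<^sub>C x) = cmod c * norm x"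
    and mult_scaleC_left: "(c *\<^sub>C x) * y = c *\<^sub>C (x * y)"
    and mult_scaleC_right: "x * (c *\<^sub>C y) = c *\<^sub>C (x * y)"
    and star_add: "star (x + y) = star x + star y"
    and star_scaleC: "star (c *\<^sub>C x) = cnj c *\<^sub>C star x"
    and star_mult: "star (x * y) = star y * star x"
    and star_star: "star (star x) = x"
    and cstar_identity: "norm (star x * x) = (norm x)\<^sup>2"

definition positives :: "'a::cstar_algebra set" where
  "positives = {star x * x | x. True}"

definition positives_with_local_unit :: "'a::cstar_algebra set" where
  "positives_with_local_unit = {a \<in> positives. \<exists>b\<in>positives. a = a * b}"

definition hjelmborg_rordam :: "'a::cstar_algebra itself \<Rightarrow> bool" where
  "hjelmborg_rordam _ \<longleftrightarrow>
     (\<forall>a \<in> (positives_with_local_unit :: 'a set). \<exists>b\<in>positives.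
        a * b = 0 \<and> (\<exists>x. a = star x * x \<and> b = x * star x))"


section \<open>The stabilization\<close>

text \<open>
  The tensor product of \<open>A\<close> with the compact operators on \<open>\<ell>\<^sup>2\<close> is the completion of
  the increasing union of the matrix algebras \<open>M\<^sub>n(A)\<close>, embedded into each other as upper left
  corners. An element \<open>S\<close> of it is determined by its entries \<open>e\<^sub>i\<^sub>i S e\<^sub>j\<^sub>j\<close> and is the norm
  limit of its corners; conversely every infinite matrix whose corners form a Cauchy sequence arises
  in this way. So the tensor product is realized below as the set of these infinite matrices.
\<close>

type_synonym 'a inf_matrix = "nat \<Rightarrow> nat \<Rightarrow> 'a"

text \<open>The norm of the standard Hilbert \<open>A\<close>-module \<open>A\<^sup>n\<close>; only the first \<open>n\<close> entries matter.\<close>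

definition column_norm :: "nat \<Rightarrow> (nat \<Rightarrow> 'a::cstar_algebra) \<Rightarrow> real" where
  "column_norm n x = sqrt (norm (\<Sum>i<n. star (x i) * x i))"

text \<open>
  The unique C*-norm on \<open>M\<^sub>n(A)\<close>, applied to the upper left \<open>n \<times> n\<close> corner of \<open>S\<close>: \<open>M\<^sub>n(A)\<close>
  acts faithfully on \<open>A\<^sup>n\<close> by adjointable operators, also for nonunital \<open>A\<close>.
\<close>

definition corner_norm :: "nat \<Rightarrow> 'a::cstar_algebra inf_matrix \<Rightarrow> real" where
  "corner_norm n S = (SUP x\<in>{x. column_norm n x \<le> 1}. column_norm n (\<lambda>i. \<Sum>j<n. S i j * x j))"

definition truncate :: "nat \<Rightarrow> 'a::cstar_algebra inf_matrix \<Rightarrow> 'a inf_matrix" where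
  "truncate n S = (\<lambda>i j. if i < n \<and> j < n then S i j else 0)"

definition stabilization :: "'a::cstar_algebra inf_matrix set" where
  "stabilization = {S. \<forall>e>0. \<exists>N. \<forall>m\<ge>N. \<forall>n\<ge>N.
     corner_norm (max m n) (\<lambda>i j. truncate m S i j - truncate n S i j) < e}"

text \<open>The norms of the corners increase to the norm of the matrix.\<close>

definition stab_norm :: "'a::cstar_algebra inf_matrix \<Rightarrow> real" where
  "stab_norm S = (SUP n. corner_norm n S)"

definition stab_zero :: "'a::cstar_algebra inf_matrix" where
  "stab_zero = (\<lambda>i j. 0)"

definition stab_add :: "'a::cstar_algebra inf_matrix \<Rightarrow> 'a inf_matrix \<Rightarrow> 'a inf_matrix" where
  "stab_add S T = (\<lambda>i j. S i j + T i j)"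

definition stab_diff :: "'a::cstar_algebra inf_matrix \<Rightarrow> 'a inf_matrix \<Rightarrow> 'a inf_matrix" where
  "stab_diff S T = (\<lambda>i j. S i j - T i j)"

text \<open>For matrices in the stabilization the series converges in norm.\<close>

definition stab_mult :: "'a::cstar_algebra inf_matrix \<Rightarrow> 'a inf_matrix \<Rightarrow> 'a inf_matrix" where
  "stab_mult S T = (\<lambda>i j. \<Sum>k. S i k * T k j)"

definition stab_star :: "'a::cstar_algebra inf_matrix \<Rightarrow> 'a inf_matrix" where
  "stab_star S = (\<lambda>i j. star (S j i))"

definition stab_positives :: "'a::cstar_algebra inf_matrix set" where
  "stab_positives = {stab_mult (stab_star X) X | X. X \<in> stabilization}"

text \<open>The embedding of \<open>A\<close> as the corner \<open>A \<otimes> e\<^sub>1\<^sub>1\<close>; indices start at \<open>0\<close> here.\<close>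

definition corner :: "'a::cstar_algebra \<Rightarrow> 'a inf_matrix" where
  "corner a = (\<lambda>i j. if i = 0 \<and> j = 0 then a else 0)"


section \<open>The Cuntz semigroup\<close>

definition cuntz_below :: "'a::cstar_algebra inf_matrix \<Rightarrow> 'a inf_matrix \<Rightarrow> bool" where
  "cuntz_below a b \<longleftrightarrow> (\<exists>r :: nat \<Rightarrow> 'a inf_matrix. (\<forall>n. r n \<in> stabilization) \<and>
     (\<lambda>n. stab_norm (stab_diff a (stab_mult (stab_mult (r n) b) (stab_star (r n)))))
       \<longlonglongrightarrow> 0)"

definition cuntz_rel :: "('a::cstar_algebra inf_matrix \<times> 'a inf_matrix) set" where
  "cuntz_rel = {(a, b). a \<in> stab_positives \<and> b \<in> stab_positives \<and>
     cuntz_below a b \<and> cuntz_below b a}"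

definition cuntz_semigroup :: "'a::cstar_algebra inf_matrix set set" where
  "cuntz_semigroup = stab_positives // cuntz_rel"

definition cuntz_class :: "'a::cstar_algebra inf_matrix \<Rightarrow> 'a inf_matrix set" where
  "cuntz_class a = cuntz_rel `` {a}"

text \<open>
  The order and the addition below are meant for elements of \<open>cuntz_semigroup\<close>. As
  \<open>cuntz_below\<close> is invariant under Cuntz equivalence, one pair of representatives decides.
\<close>

definition cuntz_le :: "'a::cstar_algebra inf_matrix set \<Rightarrow> 'a inf_matrix set \<Rightarrow> bool" where
  "cuntz_le X Y \<longleftrightarrow> (\<exists>a\<in>X. \<exists>b\<in>Y. cuntz_below a b)"

text \<open>
  Any two classes have orthogonal representatives, and the class of the sum of orthogonal
  representatives does not depend on their choice; hence the union is over copies of one class.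
\<close>

definition cuntz_add ::
    "'a::cstar_algebra inf_matrix set \<Rightarrow> 'a inf_matrix set \<Rightarrow> 'a inf_matrix set" where
  "cuntz_add X Y =
     (\<Union>a\<in>X. \<Union>b\<in>{b \<in> Y. stab_mult a b = stab_zero}. cuntz_class (stab_add a b))"

primrec cuntz_multiple ::
    "nat \<Rightarrow> 'a::cstar_algebra inf_matrix set \<Rightarrow> 'a inf_matrix set" where
  "cuntz_multiple 0 X = cuntz_class stab_zero"
| "cuntz_multiple (Suc n) X = cuntz_add X (cuntz_multiple n X)"

definition cuntz_stably_below ::
    "'a::cstar_algebra inf_matrix set \<Rightarrow> 'a inf_matrix set \<Rightarrow> bool" where
  "cuntz_stably_below X Y \<longleftrightarrow> (\<exists>n. cuntz_le (cuntz_multiple (n + 1) X) (cuntz_multiple n Y))"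

definition property_S :: "'a::cstar_algebra itself \<Rightarrow> bool" where
  "property_S _ \<longleftrightarrow>
     (\<forall>a \<in> (positives_with_local_unit :: 'a set). \<exists>b\<in>positives.
        a * b = 0 \<and> cuntz_stably_below (cuntz_class (corner a)) (cuntz_class (corner b)))"


section \<open>Quotients and softness\<close>

definition closed_ideal :: "'a::cstar_algebra set \<Rightarrow> bool" where
  "closed_ideal I \<longleftrightarrow> closed I \<and> 0 \<in> I \<and>
     (\<forall>x\<in>I. \<forall>y\<in>I. x + y \<in> I) \<and> (\<forall>c. \<forall>x\<in>I. c *\<^sub>C x \<in> I) \<and>
     (\<forall>a. \<forall>x\<in>I. a * x \<in> I \<and> x * a \<in> I)"

definition ideal_rel :: "'a::cstar_algebra set \<Rightarrow> ('a \<times> 'a) set" where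
  "ideal_rel I = {(x, y). x - y \<in> I}"

definition quotient_carrier :: "'a::cstar_algebra set \<Rightarrow> 'a set set" where
  "quotient_carrier I = UNIV // ideal_rel I"

definition quotient_mult :: "'a::cstar_algebra set \<Rightarrow> 'a set \<Rightarrow> 'a set \<Rightarrow> 'a set" where
  "quotient_mult I X Y = (\<Union>x\<in>X. \<Union>y\<in>Y. ideal_rel I `` {x * y})"

definition quotient_unital :: "'a::cstar_algebra set \<Rightarrow> bool" where
  "quotient_unital I \<longleftrightarrow> (\<exists>E\<in>quotient_carrier I. \<forall>X\<in>quotient_carrier I.
     quotient_mult I E X = X \<and> quotient_mult I X E = X)"

definition soft :: "'a::cstar_algebra itself \<Rightarrow> bool" where
  "soft _ \<longleftrightarrow> (\<forall>I :: 'a set. closed_ideal I \<and> I \<noteq> UNIV \<longrightarrow> \<not> quotient_unital I)"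

end

theory Submission
  imports Defs "HOL-Complex_Analysis.Cauchy_Integral_Formula" "HOL-Computational_Algebra.Polynomial"
begin

text \<open>
  If \<open>a\<close> has a local unit, then functional calculus provides a local unit \<open>a'\<close> of \<open>a\<close> that
  has itself a local unit. Given the Hjelmborg-Rordam property, \<open>a' = y\<^sup>* y\<close> with \<open>y y\<^sup>*\<close> orthogonal
  to \<open>a'\<close>, so \<open>y a y\<^sup>*\<close> is a copy of \<open>a\<close> orthogonal to \<open>a\<close>. The sum \<open>s\<close> of both has a local unit
  again, and a copy \<open>b\<close> of \<open>s\<close> orthogonal to \<open>s\<close> satisfies \<open>2[a] = [b]\<close>.

  If \<open>A/I\<close> is nonzero and unital, its unit lifts to some \<open>a\<close> with a local unit. If \<open>b\<close> is orthogonal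
  to \<open>a\<close>, then \<open>b \<in> I\<close>, hence every matrix in a multiple of \<open>[b]\<close> has its entries in \<open>I\<close>. As closed
  ideals are hereditary, \<open>(n+1)[a] \<le> n[b]\<close> would force \<open>a \<in> I\<close>.

  Functional calculus takes place in the unitization; its basis, the bound
  \<open>\<parallel>p h\<parallel> \<le> sup \<bar>p\<bar>\<close> for polynomials \<open>p\<close> and self-adjoint \<open>h\<close>, comes from writing \<open>h\<close> as the real
  part of a unitary, without Gelfand theory.
\<close>

section \<open>Elementary properties of C*-algebras\<close>

text \<open>Products of infinite matrices are series and \<open>stab_norm\<close> is a supremum, so
  both carry information only after an estimate. The first implication avoids such estimates by
  staying in the corner, where every series has one term; in return, even reflexivity of Cuntz
  comparison has to be witnessed by a local unit. The second implication extracts a single analytic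
  fact, that \<open>stab_norm\<close> dominates the norm of every entry. For this it is enough to
  bound the sesquilinear forms of products; that products lie in \<open>stabilization\<close> again
  is never shown.

  The local unit \<open>a'\<close> enters because \<open>star y * y = a'\<close> turns
  \<open>star y * (y * a * star y) * y = a' * a * a' = a\<close> into an exact identity. Factoring
  \<open>a\<close> itself would give the equivalence only through a limit. Passing to the sum
  \<open>s\<close> provides, orthogonally to \<open>a\<close>, one element \<open>b\<close> large
  enough for two copies of \<open>a\<close>, so that \<open>n = 1\<close> works in the definition of
  stable comparison.\<close>

lemma scaleC_minus_left: "(- c) *\<^sub>C (x::'a::cstar_algebra) = - (c *\<^sub>C x)"
  by (metis add.right_inverse add_eq_0_iff norm_eq_zero norm_scaleC scaleC_add_left mult_zero_left)

lemma scaleC_zero_right [simp]: "c *\<^sub>C (0::'a::cstar_algebra) = 0"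
  using scaleC_add_right[of c "0::'a" 0] by simp

lemma scaleC_zero_left [simp]: "0 *\<^sub>C (x::'a::cstar_algebra) = 0"
  using scaleC_add_left[of 0 0 x] by simp

lemma scaleC_one [simp]: "1 *\<^sub>C (x::'a::cstar_algebra) = x"
  using scaleR_eq_scaleC[of 1 x] by simp

lemma scaleC_minus_right: "c *\<^sub>C (- x::'a::cstar_algebra) = - (c *\<^sub>C x)"
  by (metis add.right_inverse add_eq_0_iff scaleC_add_right scaleC_zero_right)

lemma scaleC_diff_right: "c *\<^sub>C (x - y::'a::cstar_algebra) = c *\<^sub>C x - c *\<^sub>C y"
  using scaleC_add_right[of c x "- y"] by (simp add: scaleC_minus_right)

lemma star_zero [simp]: "star (0::'a::cstar_algebra) = 0"
  using star_add[of "0::'a" 0] by simp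

lemma star_minus: "star (- x::'a::cstar_algebra) = - star x"
  by (metis add.right_inverse add_eq_0_iff star_add star_zero)

lemma star_diff: "star (x - y::'a::cstar_algebra) = star x - star y"
  by (metis add_uminus_conv_diff star_add star_minus)

lemma star_scaleR: "star (r *\<^sub>R x::'a::cstar_algebra) = r *\<^sub>R star x"
  by (simp add: scaleR_eq_scaleC star_scaleC)

lemma star_sum: "star (sum f A) = (\<Sum>i\<in>A. star (f i :: 'a::cstar_algebra))"
  by (induction A rule: infinite_finite_induct) (simp_all add: star_add)

lemma norm_star [simp]: "norm (star (x::'a::cstar_algebra)) = norm x"
proof -
  have "norm y \<le> norm (star y)" for y :: 'a
  proof (cases "y = 0")
    case False
    have "norm y * norm y \<le> norm (star y) * norm y"
      using cstar_identity[of y] norm_mult_ineq[of "star y" y] by (simp add: power2_eq_square)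
    then show ?thesis
      using False by simp
  qed simp
  from this[of x] this[of "star x"] show ?thesis
    by (simp add: star_star)
qed

lemma norm_mult_star: "norm (x * star x) = (norm (x::'a::cstar_algebra))\<^sup>2"
  using cstar_identity[of "star x"] by (simp add: star_star)

lemma star_eq_zero_iff [simp]: "star (x::'a::cstar_algebra) = 0 \<longleftrightarrow> x = 0"
  by (metis norm_eq_zero norm_star)

lemma star_mult_self_eq_zero_iff: "star x * x = 0 \<longleftrightarrow> (x::'a::cstar_algebra) = 0"
  by (metis cstar_identity mult_zero_right norm_eq_zero power_eq_0_iff zero_neq_numeral)

lemma bounded_linear_star: "bounded_linear (star :: 'a::cstar_algebra \<Rightarrow> 'a)"
  by (rule bounded_linear_intro[of _ 1]) (simp_all add: star_add star_scaleR)

lemma bounded_linear_scaleC: "bounded_linear ((*\<^sub>C) c :: 'a::cstar_algebra \<Rightarrow> 'a)"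
  by (rule bounded_linear_intro[of _ "cmod c"])
    (simp_all add: scaleC_add_right scaleR_eq_scaleC scaleC_scaleC norm_scaleC mult.commute)

text \<open>Here \<open>1\<close> has norm 1, which excludes the zero algebra; the unitization below
  belongs to this class for every \<open>A\<close>, even for \<open>A = 0\<close>.\<close>

class cstar_algebra_1 = cstar_algebra + real_normed_algebra_1

lemma star_one [simp]: "star (1::'a::cstar_algebra_1) = 1"
  by (metis mult.right_neutral star_mult star_star)

lemma star_of_real [simp]: "star (of_real r::'a::cstar_algebra_1) = of_real r"
  by (simp add: of_real_def star_scaleR)

lemma star_power: "star (x ^ n) = star (x::'a::cstar_algebra_1) ^ n"
  by (induction n) (simp_all add: star_mult power_commutes)

section \<open>The unitization\<close>

datatype 'a unitization = Unitize (alg: 'a) (scal: complex)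

text \<open>Left multiplication by \<open>z\<close> in the unitization, restricted to the ideal
  \<open>A\<close>, where a norm is already available.\<close>

definition act :: "'a::cstar_algebra unitization \<Rightarrow> 'a \<Rightarrow> 'a" where
  "act z x = alg z * x + scal z *\<^sub>C x"

lemma bounded_linear_act: "bounded_linear (act z)"
  unfolding act_def
  by (intro bounded_linear_add bounded_linear_mult_right bounded_linear_scaleC)

instantiation unitization :: (cstar_algebra) real_algebra_1
begin

definition "0 = Unitize 0 0"
definition "1 = Unitize 0 1"
definition "z + w = Unitize (alg z + alg w) (scal z + scal w)"
definition "z - w = Unitize (alg z - alg w) (scal z - scal w)"
definition "- z = Unitize (- alg z) (- scal z)"
definition "z * w = Unitize (alg z * alg w + scal z *\<^sub>C alg w + scal w *\<^sub>C alg z) (scal z * scal w)"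
definition "r *\<^sub>R z = Unitize (r *\<^sub>R alg z) (r *\<^sub>R scal z)"

instance
  by standard
    (simp_all add: zero_unitization_def one_unitization_def plus_unitization_def
      minus_unitization_def uminus_unitization_def times_unitization_def scaleR_unitization_def
      unitization.expand algebra_simps scaleC_add_left scaleC_add_right scaleC_scaleC
      mult_scaleC_left mult_scaleC_right scaleR_eq_scaleC scaleR_conv_of_real)

end

lemma unitization_sel [simp]:
  "alg 0 = 0" "scal 0 = 0" "alg 1 = 0" "scal 1 = 1"
  "alg (z + w) = alg z + alg w" "scal (z + w) = scal z + scal w"
  "alg (z - w) = alg z - alg w" "scal (z - w) = scal z - scal w"
  "alg (- z) = - alg z" "scal (- z) = - scal z"
  "alg (z * w) = alg z * alg w + scal z *\<^sub>C alg w + scal w *\<^sub>C alg z"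
  "scal (z * w) = scal z * scal w"
  "alg (r *\<^sub>R z) = r *\<^sub>R alg z" "scal (r *\<^sub>R z) = r *\<^sub>R scal z"
  for z w :: "'a::cstar_algebra unitization"
  by (simp_all add: zero_unitization_def one_unitization_def plus_unitization_def
      minus_unitization_def uminus_unitization_def times_unitization_def scaleR_unitization_def)

lemma act_simps:
  "act (z + w) x = act z x + act w x" "act (z * w) x = act z (act w x)"
  "act (r *\<^sub>R z) x = r *\<^sub>R act z x" "act 0 x = 0" "act 1 x = x"
  by (simp_all add: act_def algebra_simps scaleC_add_left scaleC_add_right scaleC_scaleC
      mult_scaleC_left mult_scaleC_right scaleR_eq_scaleC[where 'a = 'a]
      scaleR_conv_of_real[where 'a = complex])

lemma act_fun_simps:
  "act (z + w) = (\<lambda>x. act z x + act w x)" "act (z * w) = act z \<circ> act w"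
  "act (r *\<^sub>R z) = (\<lambda>x. r *\<^sub>R act z x)" "act 0 = (\<lambda>x. 0)"
  by (auto simp: act_simps)

instantiation unitization :: (cstar_algebra) real_normed_algebra_1
begin

text \<open>The operator norm on \<open>A\<close> alone vanishes at \<open>1 - emb e\<close> when
  \<open>A\<close> already has a unit \<open>e\<close>. Taking the maximum with the character
  \<open>scal\<close> gives a faithful norm for unital and nonunital \<open>A\<close> alike.\<close>

definition "norm z = max (cmod (scal z)) (onorm (act z))"
definition dist_unitization :: "'a unitization \<Rightarrow> 'a unitization \<Rightarrow> real"
  where "dist_unitization z w = norm (z - w)"
definition sgn_unitization :: "'a unitization \<Rightarrow> 'a unitization"
  where "sgn_unitization z = z /\<^sub>R norm z"
definition uniformity_unitization :: "('a unitization \<times> 'a unitization) filter"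
  where "uniformity_unitization = (INF e\<in>{0<..}. principal {(z, w). dist z w < e})"
definition open_unitization :: "'a unitization set \<Rightarrow> bool"
  where "open_unitization U =
    (\<forall>z\<in>U. eventually (\<lambda>(z', w). z' = z \<longrightarrow> w \<in> U) uniformity)"

instance
proof
  fix z w :: "'a unitization" and r :: real
  note bl = bounded_linear_act
  show "norm z = 0 \<longleftrightarrow> z = 0"
  proof
    assume *: "norm z = 0"
    then have "scal z = 0"
      using norm_ge_zero[of "scal z"] by (simp add: norm_unitization_def max_def split: if_splits)
    moreover have "onorm (act z) \<le> 0"
      using * by (simp add: norm_unitization_def max_def split: if_splits)
    then have "act z (star (alg z)) = 0"
      using onorm[OF bl, of z "star (alg z)"]
      by (metis mult_nonpos_nonneg norm_ge_zero norm_le_zero_iff order_trans)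
    ultimately have "alg z * star (alg z) = 0"
      by (simp add: act_def)
    then have "alg z = 0"
      by (metis norm_eq_zero norm_mult_star power_eq_0_iff)
    then show "z = 0"
      using \<open>scal z = 0\<close> by (simp add: unitization.expand)
  next
    assume "z = 0"
    then show "norm z = 0"
      by (simp add: norm_unitization_def act_fun_simps onorm_zero)
  qed
  have "onorm (act (z + w)) \<le> onorm (act z) + onorm (act w)"
    using onorm_triangle[OF bl bl, of z w] by (simp add: act_fun_simps)
  then show "norm (z + w) \<le> norm z + norm w"
    using norm_triangle_ineq[of "scal z" "scal w"] by (auto simp: norm_unitization_def)
  have "onorm (act (r *\<^sub>R z)) = \<bar>r\<bar> * onorm (act z)"
    using onorm_scaleR[OF bl, of r z] by (simp add: act_fun_simps)
  then show "norm (r *\<^sub>R z) = \<bar>r\<bar> * norm z"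
    by (simp add: norm_unitization_def max_mult_distrib_left)
  have "onorm (act (z * w)) \<le> onorm (act z) * onorm (act w)"
    using onorm_compose[OF bl bl] by (simp add: act_fun_simps)
  also have "\<dots> \<le> norm z * norm w"
    by (intro mult_mono) (auto simp: norm_unitization_def onorm_pos_le[OF bl] le_max_iff_disj)
  finally have "onorm (act (z * w)) \<le> norm z * norm w" .
  moreover have "cmod (scal (z * w)) \<le> norm z * norm w"
    by (simp add: norm_mult) (intro mult_mono, auto simp: norm_unitization_def le_max_iff_disj)
  ultimately show "norm (z * w) \<le> norm z * norm w"
    by (simp add: norm_unitization_def[of "z * w"])
  have "onorm (act (1::'a unitization)) \<le> 1"
    by (rule onorm_bound) (simp_all add: act_simps)
  then show "norm (1::'a unitization) = 1"
    by (simp add: norm_unitization_def)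
qed (auto simp: dist_unitization_def sgn_unitization_def uniformity_unitization_def
      open_unitization_def)

end

definition emb :: "'a::cstar_algebra \<Rightarrow> 'a unitization" where
  "emb a = Unitize a 0"

lemma emb_sel [simp]: "alg (emb a) = a" "scal (emb a) = 0"
  by (simp_all add: emb_def)

lemma emb_alg: "scal z = 0 \<Longrightarrow> emb (alg z) = z"
  by (simp add: unitization.expand)

lemma norm_emb [simp]: "norm (emb a) = norm (a::'a::cstar_algebra)"
proof -
  have "onorm (act (emb a)) = norm a"
  proof (rule antisym)
    show "onorm (act (emb a)) \<le> norm a"
      by (rule onorm_bound) (simp_all add: act_def norm_mult_ineq)
    have "(norm a)\<^sup>2 \<le> onorm (act (emb a)) * norm a"
      using onorm[OF bounded_linear_act, of "emb a" "star a"] by (simp add: act_def norm_mult_star)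
    then show "norm a \<le> onorm (act (emb a))"
      using onorm_pos_le[OF bounded_linear_act, of "emb a"]
      by (cases "a = 0") (simp_all add: power2_eq_square)
  qed
  then show ?thesis
    by (simp add: norm_unitization_def)
qed

lemma emb_simps:
  "emb (a + b) = emb a + emb b" "emb (a - b) = emb a - emb b" "emb (a * b) = emb a * emb b"
  "emb (r *\<^sub>R a) = r *\<^sub>R emb a" "emb 0 = 0" "emb (- a) = - emb a"
  by (simp_all add: unitization.expand)

lemma emb_eq_iff [simp]: "emb a = emb b \<longleftrightarrow> a = b"
  by (simp add: emb_def)

lemma unitization_decomp: "z = emb (alg z) + Unitize 0 (scal z)"
  by (simp add: unitization.expand)

lemma bounded_linear_emb: "bounded_linear emb"
  by (rule bounded_linear_intro[of _ 1]) (simp_all add: emb_simps)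

lemma cmod_scal_le: "cmod (scal z) \<le> norm z"
  by (simp add: norm_unitization_def)

lemma bounded_linear_scal: "bounded_linear scal"
  by (rule bounded_linear_intro[of _ 1]) (simp_all add: cmod_scal_le)

lemma norm_Unitize_zero: "norm (Unitize 0 c) = cmod c"
proof -
  have "onorm (act (Unitize (0::'a) c)) \<le> cmod c"
    by (rule onorm_bound) (simp_all add: act_def norm_scaleC)
  then show ?thesis
    by (simp add: norm_unitization_def)
qed

text \<open>The scalar parts converge by themselves. What remains is a Cauchy sequence in the image
  of the isometry \<open>emb\<close>, and \<open>A\<close> is complete.\<close>

instance unitization :: (cstar_algebra) banach
proof
  fix X :: "nat \<Rightarrow> 'a unitization"
  assume X: "Cauchy X"
  have S: "Cauchy (\<lambda>n. scal (X n))"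
    by (rule bounded_linear.Cauchy[OF bounded_linear_scal X])
  have "bounded_linear (\<lambda>c. Unitize (0::'a) c)"
    by (rule bounded_linear_intro[of _ 1]) (simp_all add: unitization.expand norm_Unitize_zero)
  note T = bounded_linear.Cauchy[OF this S]
  have "Cauchy (\<lambda>n. X n - Unitize 0 (scal (X n)))"
  proof (rule metric_CauchyI)
    fix e :: real
    assume "e > 0"
    obtain M where M: "\<And>m n. m \<ge> M \<Longrightarrow> n \<ge> M \<Longrightarrow> dist (X m) (X n) < e / 2"
      using metric_CauchyD[OF X, of "e / 2"] \<open>e > 0\<close> by auto
    obtain N where N: "\<And>m n. m \<ge> N \<Longrightarrow> n \<ge> N \<Longrightarrow>
        dist (Unitize (0::'a) (scal (X m))) (Unitize 0 (scal (X n))) < e / 2"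
      using metric_CauchyD[OF T, of "e / 2"] \<open>e > 0\<close> by auto
    have "dist (X m - Unitize 0 (scal (X m))) (X n - Unitize 0 (scal (X n))) < e"
      if "m \<ge> max M N" "n \<ge> max M N" for m n
    proof -
      have "dist (X m - Unitize 0 (scal (X m))) (X n - Unitize 0 (scal (X n)))
          \<le> dist (X m) (X n) + dist (Unitize (0::'a) (scal (X m))) (Unitize 0 (scal (X n)))"
        by (smt (verit) dist_norm norm_triangle_ineq4 diff_diff_eq diff_diff_eq2 add_diff_eq diff_add_eq
            add.commute)
      then show ?thesis
        using M[of m n] N[of m n] that by simp
    qed
    then show "\<exists>M. \<forall>m\<ge>M. \<forall>n\<ge>M.
        dist (X m - Unitize 0 (scal (X m))) (X n - Unitize 0 (scal (X n))) < e"
      by blast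
  qed
  moreover have "X n - Unitize 0 (scal (X n)) = emb (alg (X n))" for n
    by (simp add: unitization.expand)
  ultimately have "Cauchy (\<lambda>n. emb (alg (X n)))"
    by simp
  then have "Cauchy (\<lambda>n. alg (X n))"
    by (simp add: Cauchy_def dist_norm flip: emb_simps)
  then obtain a where "(\<lambda>n. alg (X n)) \<longlonglongrightarrow> a"
    using convergent_def Cauchy_convergent by blast
  then have "(\<lambda>n. emb (alg (X n))) \<longlonglongrightarrow> emb a"
    by (rule bounded_linear.tendsto[OF bounded_linear_emb])
  moreover obtain c where "(\<lambda>n. scal (X n)) \<longlonglongrightarrow> c"
    using S convergent_def Cauchy_convergent by blast
  then have "(\<lambda>n. Unitize (0::'a) (scal (X n))) \<longlonglongrightarrow> Unitize 0 c"
    by (rule bounded_linear.tendsto[OF \<open>bounded_linear (\<lambda>c. Unitize (0::'a) c)\<close>])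
  ultimately have "(\<lambda>n. emb (alg (X n)) + Unitize 0 (scal (X n))) \<longlonglongrightarrow> emb a + Unitize 0 c"
    by (rule tendsto_add)
  then show "convergent X"
    unfolding convergent_def by (metis (no_types, lifting) ext unitization_decomp)
qed

instantiation unitization :: (cstar_algebra) cstar_algebra_1
begin

definition "c *\<^sub>C z = Unitize (c *\<^sub>C alg z) (c * scal z)"
definition "star z = Unitize (star (alg z)) (cnj (scal z))"

lemma star_unitization_sel: "alg (star z) = star (alg z)" "scal (star z) = cnj (scal z)"
  for z :: "'a unitization"
  by (simp_all add: star_unitization_def)

lemma star_mult_unitization: "star (z * w) = star w * star z" for z w :: "'a unitization"
  by (simp add: unitization.expand star_unitization_sel star_add star_mult star_scaleC add_ac)

lemma star_star_unitization: "star (star z) = z" for z :: "'a unitization"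
  by (simp add: unitization.expand star_unitization_sel star_star)

text \<open>The hard half of the C*-identity. With \<open>A\<close> as a Hilbert module over itself,
  the inner square of \<open>act z x\<close> is \<open>star x * act (star z * z) x\<close>, and the
  C*-identity of \<open>A\<close> makes this a norm estimate.\<close>

lemma onorm_act_star_mult: "(onorm (act z))\<^sup>2 \<le> onorm (act (star z * z))" for z :: "'a unitization"
proof -
  let ?n = "onorm (act (star z * z))"
  have n: "0 \<le> ?n"
    by (rule onorm_pos_le[OF bounded_linear_act])
  have "norm (act z x) \<le> sqrt ?n * norm x" for x
  proof -
    have "star (act z x) * act z x = star x * act (star z * z) x"
      by (simp add: act_simps)
        (simp add: act_def star_add star_mult star_scaleC algebra_simps mult_scaleC_left
          mult_scaleC_right scaleC_add_right scaleC_scaleC star_unitization_sel)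
    then have "(norm (act z x))\<^sup>2 = norm (star x * act (star z * z) x)"
      by (metis cstar_identity)
    also have "\<dots> \<le> norm x * (?n * norm x)"
      by (rule order_trans[OF norm_mult_ineq])
        (simp add: mult_left_mono onorm[OF bounded_linear_act])
    also have "\<dots> = (sqrt ?n * norm x)\<^sup>2"
      using n by (simp add: power_mult_distrib power2_eq_square)
    finally show ?thesis
      by (rule power2_le_imp_le) (simp add: n)
  qed
  then have "onorm (act z) \<le> sqrt ?n"
    by (intro onorm_bound) (simp_all add: n)
  then show ?thesis
    using n onorm_pos_le[OF bounded_linear_act, of z] real_le_rsqrt
    by (metis real_sqrt_le_iff real_sqrt_pow2 power_mono)
qed

lemma onorm_act_mult: "onorm (act (z * w)) \<le> onorm (act z) * onorm (act w)"
  for z w :: "'a unitization"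
  using onorm_compose[OF bounded_linear_act bounded_linear_act, of z w]
  by (simp add: act_fun_simps)

lemma onorm_act_le_star: "onorm (act z) \<le> onorm (act (star z))" for z :: "'a unitization"
proof -
  have "(onorm (act z))\<^sup>2 \<le> onorm (act (star z)) * onorm (act z)"
    using onorm_act_star_mult onorm_act_mult order_trans by blast
  then show ?thesis
    using onorm_pos_le[OF bounded_linear_act, of z] onorm_pos_le[OF bounded_linear_act, of "star z"]
    by (cases "onorm (act z) = 0") (simp_all add: power2_eq_square)
qed

instance
proof
  fix z w :: "'a unitization" and c d :: complex and r :: real
  show "norm (c *\<^sub>C z) = cmod c * norm z"
  proof -
    have le: "onorm (act (c *\<^sub>C z)) \<le> cmod c * onorm (act z)" for c and z :: "'a unitization"
    proof (rule onorm_bound)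
      fix x
      have "act (c *\<^sub>C z) x = c *\<^sub>C act z x"
        by (simp add: act_def scaleC_unitization_def scaleC_add_right scaleC_scaleC mult_scaleC_left)
      then show "norm (act (c *\<^sub>C z) x) \<le> cmod c * onorm (act z) * norm x"
        using onorm[OF bounded_linear_act, of z x] by (simp add: norm_scaleC mult.assoc mult_left_mono)
    qed (simp add: onorm_pos_le[OF bounded_linear_act])
    have "onorm (act (c *\<^sub>C z)) = cmod c * onorm (act z)"
    proof (cases "c = 0")
      case True
      then show ?thesis
        using le[of c z] onorm_pos_le[OF bounded_linear_act, of "c *\<^sub>C z"] by simp
    next
      case False
      have "inverse c *\<^sub>C c *\<^sub>C z = z"
        using False by (simp add: scaleC_unitization_def unitization.expand scaleC_scaleC)
      then have "onorm (act z) \<le> inverse (cmod c) * onorm (act (c *\<^sub>C z))"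
        using le[of "inverse c" "c *\<^sub>C z"] by (simp add: norm_inverse)
      then have "cmod c * onorm (act z) \<le> onorm (act (c *\<^sub>C z))"
        using False by (simp add: field_simps)
      then show ?thesis
        using le[of c z] by simp
    qed
    then show ?thesis
      by (simp add: norm_unitization_def scaleC_unitization_def norm_mult max_mult_distrib_left)
  qed
  show "norm (star z * z) = (norm z)\<^sup>2"
  proof -
    have "onorm (act (star z)) = onorm (act z)"
      using onorm_act_le_star[of z] onorm_act_le_star[of "star z"]
      by (simp add: star_star_unitization)
    then have "onorm (act (star z * z)) = (onorm (act z))\<^sup>2"
      using onorm_act_star_mult[of z] onorm_act_mult[of "star z" z] by (simp add: power2_eq_square)
    moreover have "cmod (scal (star z * z)) = (cmod (scal z))\<^sup>2"
      by (simp add: star_unitization_sel norm_mult power2_eq_square)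
    moreover have "max (a\<^sup>2) (b\<^sup>2) = (max a b)\<^sup>2" if "0 \<le> a" "0 \<le> b" for a b :: real
      using that by (auto simp: max_def power2_le_iff_abs_le intro: antisym)
    ultimately show ?thesis
      using onorm_pos_le[OF bounded_linear_act, of z] by (simp add: norm_unitization_def)
  qed
  show "star (z * w) = star w * star z"
    by (rule star_mult_unitization)
  show "star (star z) = z"
    by (rule star_star_unitization)
qed (simp_all add: scaleC_unitization_def unitization.expand star_unitization_sel star_add star_mult
    star_scaleC scaleC_add_left scaleC_add_right scaleC_scaleC mult_scaleC_left mult_scaleC_right
    algebra_simps scaleR_eq_scaleC[where 'a = 'a] scaleR_conv_of_real[where 'a = complex])

end

lemma emb_star: "emb (star a) = star (emb a)"
  by (simp add: unitization.expand star_unitization_def)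

lemma emb_sum: "emb (sum f A) = (\<Sum>i\<in>A. emb (f i))"
  by (induction A rule: infinite_finite_induct) (simp_all add: emb_simps)

section \<open>Continuous functional calculus of a self-adjoint element\<close>

text \<open>Lets a geometric series dominate the binomial series of the square root.\<close>

lemma abs_half_gchoose_le_one: "\<bar>(1/2 :: real) gchoose k\<bar> \<le> 1"
proof (induction k)
  case (Suc k)
  have "(1/2 gchoose Suc k :: real) = (1/2 gchoose k) * ((1/2 - real k) / real (Suc k))"
    using gbinomial_mult_1[of "1/2::real" k] by (simp add: field_simps)
  moreover have "\<bar>(1/2 - real k) / real (Suc k)\<bar> \<le> 1"
    by (simp add: abs_le_iff field_simps)
  ultimately show ?case
    using Suc mult_mono[OF Suc, of "\<bar>(1/2 - real k) / real (Suc k)\<bar>" 1] by (simp add: abs_mult)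
qed simp

text \<open>The binomial series is squared by the Cauchy product, and Vandermonde's identity
  collapses the coefficients to those of \<open>1 - x\<close>. Commutation is recorded because the
  root of \<open>1 - h * h\<close> has to commute with \<open>h\<close>.\<close>

lemma sqrt_one_minus_exists:
  fixes x :: "'a::cstar_algebra_1"
  assumes x: "norm x < 1" and sa: "star x = x"
  obtains w where "w * w = 1 - x" "star w = w" "\<And>y. y * x = x * y \<Longrightarrow> y * w = w * y"
proof -
  define c :: "nat \<Rightarrow> real" where "c k = (-1) ^ k * (1/2 gchoose k)" for k
  define a where "a k = c k *\<^sub>R x ^ k" for k
  have c: "\<bar>c k\<bar> \<le> 1" for k
    by (simp add: c_def abs_mult abs_half_gchoose_le_one)
  have *: "summable (\<lambda>k. norm (a k))"
  proof (rule summable_comparison_test)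
    show "\<exists>N. \<forall>n\<ge>N. norm (norm (a n)) \<le> norm x ^ n"
      using mult_mono[OF c norm_power_ineq[of x]] by (auto simp: a_def)
  qed (simp add: x summable_geometric)
  have sum: "a sums suminf a"
    using * summable_norm_cancel summable_sums by blast
  have "(\<Sum>i\<le>k. a i * a (k - i)) = ((-1) ^ k * (1 gchoose k)) *\<^sub>R x ^ k" for k
  proof -
    have "(\<Sum>i\<le>k. a i * a (k - i)) = (\<Sum>i\<le>k. (c i * c (k - i)) *\<^sub>R x ^ k)"
      by (intro sum.cong) (auto simp: a_def simp flip: power_add)
    also have "\<dots> = (\<Sum>i\<le>k. c i * c (k - i)) *\<^sub>R x ^ k"
      by (simp add: scaleR_left.sum)
    also have "(\<Sum>i\<le>k. c i * c (k - i)) = (\<Sum>i\<le>k. (-1) ^ k * ((1/2 gchoose i) * (1/2 gchoose (k - i))))"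
    proof (rule sum.cong)
      fix i
      assume "i \<in> {..k}"
      then have "(-1 :: real) ^ i * (-1) ^ (k - i) = (-1) ^ k"
        by (simp flip: power_add)
      moreover have "c i * c (k - i) =
          ((-1) ^ i * (-1) ^ (k - i)) * ((1/2 gchoose i) * (1/2 gchoose (k - i)))"
        by (simp only: c_def mult_ac)
      ultimately show "c i * c (k - i) = (-1) ^ k * ((1/2 gchoose i) * (1/2 gchoose (k - i)))"
        by simp
    qed simp
    also have "\<dots> = (-1) ^ k * (1 gchoose k)"
      using gbinomial_Vandermonde[of "1/2::real" "1/2" k] by (simp add: atLeast0AtMost flip: sum_distrib_left)
    finally show ?thesis .
  qed
  moreover have "(1 gchoose k :: real) = (if k \<le> 1 then 1 else 0)" for k
    using binomial_gbinomial[of 1 k, where 'a = real] by (cases k; cases "k - 1") auto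
  ultimately have "(\<lambda>k. ((-1) ^ k * (if k \<le> 1 then 1 else 0)) *\<^sub>R x ^ k) sums (suminf a * suminf a)"
    using Cauchy_product_sums[OF * *] by simp
  moreover have "(\<lambda>k. ((-1) ^ k * (if k \<le> 1 then 1 else 0)) *\<^sub>R x ^ k) sums
      (\<Sum>k\<le>1. ((-1) ^ k * (if k \<le> 1 then 1 else 0)) *\<^sub>R x ^ k)"
    by (rule sums_finite) auto
  ultimately have "suminf a * suminf a = (\<Sum>k\<le>1. ((-1) ^ k * (if k \<le> 1 then 1 else 0)) *\<^sub>R x ^ k)"
    using sums_unique2 by blast
  then have "suminf a * suminf a = 1 - x"
    by simp
  moreover have "star (suminf a) = suminf a"
  proof -
    have "(\<lambda>k. star (a k)) = a"
      by (simp add: fun_eq_iff a_def star_scaleR star_power sa)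
    then show ?thesis
      using bounded_linear.sums[OF bounded_linear_star sum] sum sums_unique2 by metis
  qed
  moreover have "y * suminf a = suminf a * y" if "y * x = x * y" for y
  proof -
    have "y * x ^ k = x ^ k * y" for k
      by (metis that power_commuting_commutes)
    then have "y * a k = a k * y" for k
      by (simp add: a_def)
    then show ?thesis
      using sums_mult[OF sum, of y] sums_mult2[OF sum, of y] sums_unique2 by simp
  qed
  ultimately show ?thesis
    using that by blast
qed

text \<open>For \<open>u = h + i (1 - h\<^sup>2)\<^bsup>1/2\<^esup>\<close>, so that \<open>h\<close> is the real part of \<open>u\<close>.\<close>

lemma unitary_with_real_part:
  fixes h :: "'a::cstar_algebra_1"
  assumes h: "norm h < 1" and sa: "star h = h"
  obtains u where "star u * u = 1" "u * u + 1 = 2 *\<^sub>R (h * u)" "u * h = h * u"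
proof -
  have "norm (h * h) < 1"
    using h norm_mult_ineq[of h h] mult_strict_mono[of "norm h" 1 "norm h" 1] by simp
  moreover have "star (h * h) = h * h"
    by (simp add: star_mult sa)
  ultimately obtain w where w: "w * w = 1 - h * h" "star w = w"
    and comm: "\<And>y. y * (h * h) = h * h * y \<Longrightarrow> y * w = w * y"
    by (rule sqrt_one_minus_exists) blast
  have hw: "h * w = w * h"
    by (rule comm) (simp add: mult.assoc)
  define u where "u = h + \<i> *\<^sub>C w"
  have "star u * u = h * h + w * w"
    by (simp add: u_def star_add star_scaleC sa w(2) algebra_simps mult_scaleC_left mult_scaleC_right
        scaleC_scaleC hw scaleC_minus_left scaleC_diff_right)
  moreover have "u * u + w * w = h * h + 2 *\<^sub>R (h * \<i> *\<^sub>C w)"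
    by (simp add: u_def algebra_simps mult_scaleC_left mult_scaleC_right scaleC_scaleC hw
        scaleC_minus_left scaleC_diff_right scaleC_add_right scaleR_2)
  moreover have "u * h = h * u"
    by (simp add: u_def algebra_simps mult_scaleC_left mult_scaleC_right hw)
  ultimately show ?thesis
    using that[of u] w(1) by (simp add: u_def algebra_simps scaleR_2)
qed

text \<open>Horner's scheme at a point of a possibly noncommutative algebra. Real coefficients are
  central, which makes \<open>pev h\<close> multiplicative.\<close>

definition pev :: "'a::real_algebra_1 \<Rightarrow> real poly \<Rightarrow> 'a" where
  "pev h p = fold_coeffs (\<lambda>a b. of_real a + h * b) p 0"

lemma pev_0 [simp]: "pev h 0 = 0"
  by (simp add: pev_def)

lemma pev_pCons [simp]: "pev h (pCons a p) = of_real a + h * pev h p"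
  by (cases "p = 0 \<and> a = 0") (auto simp: pev_def)

lemma pev_1 [simp]: "pev h 1 = 1"
  by (simp add: one_pCons)

lemma pev_add: "pev h (p + q) = pev h p + pev h q"
  by (induction p q rule: poly_induct2) (simp_all add: algebra_simps)

lemma pev_smult: "pev h (smult a p) = a *\<^sub>R pev h p"
  by (induction p) (simp_all add: algebra_simps of_real_def)

lemma pev_minus: "pev h (- p) = - pev h p"
  using pev_smult[of h "-1" p] by simp

lemma pev_diff: "pev h (p - q) = pev h p - pev h q"
  using pev_add[of h p "- q"] by (simp add: pev_minus)

lemma pev_commute: "y * h = h * y \<Longrightarrow> y * pev h p = pev h p * y"
  by (induction p) (simp_all add: algebra_simps of_real_def, metis mult.assoc)

lemma pev_mult: "pev h (p * q) = pev h p * pev h q"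
  by (induction p) (simp_all add: pev_add pev_smult algebra_simps of_real_def)

lemma pev_power: "pev h (p ^ n) = pev h p ^ n"
  by (induction n) (simp_all add: pev_mult)

lemma pev_pcompose_linear: "pev h (pcompose p [:0, r:]) = pev (r *\<^sub>R h) p"
  by (induction p) (simp_all add: pcompose_pCons pev_add pev_mult pev_smult)

lemma pev_intertwine: "x * y = y * z \<Longrightarrow> pev x p * y = y * pev z p"
  by (induction p) (simp_all add: algebra_simps of_real_def, metis mult.assoc)

lemma star_pev: "star h = h \<Longrightarrow> star (pev h p) = pev (h::'a::cstar_algebra_1) p"
  by (induction p) (simp_all add: star_add star_mult pev_commute)

lemma continuous_pev: "isCont (\<lambda>h::'a::real_normed_algebra_1. pev h p) x"
  by (induction p) (auto intro!: continuous_intros)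

text \<open>Complex coefficients, because Cauchy's estimate bounds them by values on the unit
  circle; the argument will be the unitary \<open>u\<close>.\<close>

definition cpev :: "'a::cstar_algebra_1 \<Rightarrow> complex poly \<Rightarrow> 'a" where
  "cpev h p = fold_coeffs (\<lambda>a b. a *\<^sub>C 1 + h * b) p 0"

lemma cpev_0 [simp]: "cpev h 0 = 0"
  by (simp add: cpev_def)

lemma cpev_pCons [simp]: "cpev h (pCons a p) = a *\<^sub>C 1 + h * cpev h p"
  by (cases "p = 0 \<and> a = 0") (auto simp: cpev_def)

lemma cpev_add: "cpev h (p + q) = cpev h p + cpev h q"
  by (induction p q rule: poly_induct2) (simp_all add: algebra_simps scaleC_add_left)

lemma cpev_smult: "cpev h (smult a p) = a *\<^sub>C cpev h p"
  by (induction p) (simp_all add: scaleC_add_right scaleC_scaleC mult_scaleC_right)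

lemma cpev_monom: "cpev h (monom a n) = a *\<^sub>C h ^ n"
  by (induction n) (simp_all add: monom_0 monom_Suc mult_scaleC_right)

lemma norm_cpev_le:
  assumes "norm u \<le> 1" "degree q \<le> n" "\<And>k. cmod (coeff q k) \<le> M"
  shows "norm (cpev u q) \<le> (real n + 1) * M"
  using assms(2,3)
proof (induction n arbitrary: q)
  case 0
  then obtain a where "q = [:a:]"
    using degree_eq_zeroE by blast
  then show ?case
    using "0.prems"(2)[of 0] by (simp add: norm_scaleC)
next
  case (Suc n)
  obtain a q' where q: "q = pCons a q'"
    by (cases q)
  have "degree q' \<le> n"
    using Suc.prems(1) by (cases "q' = 0") (auto simp: q)
  moreover have "cmod (coeff q' k) \<le> M" for k
    using Suc.prems(2)[of "Suc k"] by (simp add: q)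
  ultimately have *: "norm (cpev u q') \<le> (real n + 1) * M"
    by (rule Suc.IH)
  have "norm (cpev u q) \<le> cmod a + norm u * norm (cpev u q')"
    unfolding q by (simp, rule norm_triangle_le) (simp add: norm_scaleC norm_mult_ineq add_mono)
  also have "\<dots> \<le> M + 1 * ((real n + 1) * M)"
    using Suc.prems(2)[of 0] *
    by (intro add_mono mult_mono) (auto simp: q assms(1) intro: order_trans[OF norm_ge_zero])
  finally show ?case
    by (simp add: algebra_simps)
qed

text \<open>Cauchy's inequality at radius 1 for the \<open>k\<close>-th derivative at 0.\<close>

lemma coeff_bound_unit_circle:
  fixes q :: "complex poly"
  assumes "\<And>z. cmod z = 1 \<Longrightarrow> cmod (poly q z) \<le> M"
  shows "cmod (coeff q k) \<le> M"
proof -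
  have "deriv (poly r) = poly (pderiv r)" for r :: "complex poly"
    by (simp add: fun_eq_iff DERIV_imp_deriv[OF poly_DERIV])
  then have "(deriv ^^ k) (poly q) = poly ((pderiv ^^ k) q)"
    by (induction k) simp_all
  then have "(deriv ^^ k) (poly q) 0 = fact k * coeff q k"
    by (simp add: poly_0_coeff_0 coeff_higher_pderiv pochhammer_fact)
  moreover have "cmod ((deriv ^^ k) (poly q) 0) \<le> fact k * M / 1 ^ k"
    by (rule Cauchy_inequality) (auto intro!: holomorphic_intros continuous_intros assms)
  ultimately show ?thesis
    by (simp add: norm_mult)
qed

text \<open>Formally \<open>h\<close> is \<open>(u + inverse u) / 2\<close>, and the factor
  \<open>u ^ d\<close> clears the negative powers. The scalar identity is the same computation on
  the unit circle, where \<open>cnj z\<close> is the inverse of \<open>z\<close> and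
  \<open>Re z\<close> takes the place of \<open>h\<close>.\<close>

lemma poly_in_real_part:
  fixes u h :: "'a::cstar_algebra_1"
  assumes u: "u * u + 1 = 2 *\<^sub>R (h * u)" "u * h = h * u" and "degree p \<le> d"
  shows "\<exists>q. degree q \<le> 2 * d \<and> (\<forall>z. cmod z = 1 \<longrightarrow> poly q z = z ^ d * of_real (poly p (Re z))) \<and>
    cpev u q = u ^ d * pev h p"
  using assms(3)
proof (induction d arbitrary: p)
  case 0
  then obtain a where "p = [:a:]"
    using degree_eq_zeroE by blast
  then show ?case
    by (intro exI[of _ "[:of_real a:]"]) (simp add: of_real_def scaleR_eq_scaleC)
next
  case (Suc d)
  obtain a p' where p: "p = pCons a p'"
    by (cases p)
  have "degree p' \<le> d"
    using Suc.prems by (cases "p' = 0") (auto simp: p)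
  then obtain q where q: "degree q \<le> 2 * d"
      "\<And>z. cmod z = 1 \<Longrightarrow> poly q z = z ^ d * of_real (poly p' (Re z))"
      "cpev u q = u ^ d * pev h p'"
    using Suc.IH by blast
  \<comment> \<open>For \<open>p = a + X p'\<close> multiplied by \<open>X ^ (d + 1)\<close>: one
    factor \<open>X\<close> turns multiplication by \<open>h\<close> into
    \<open>(X ^ 2 + 1) / 2\<close>, and the other \<open>d\<close> factors are absorbed in
    \<open>q\<close>.\<close>
  let ?q = "monom (of_real a) (Suc d) + smult (1/2) (q + pCons 0 (pCons 0 q))"
  have "degree (pCons 0 (pCons 0 q)) \<le> 2 * Suc d"
    using q(1) degree_pCons_le[of 0 q] degree_pCons_le[of 0 "pCons 0 q"] by simp
  then have "degree ?q \<le> 2 * Suc d"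
    using q(1) by (intro degree_add_le order_trans[OF degree_smult_le] order_trans[OF degree_monom_le]) auto
  moreover have "poly ?q z = z ^ Suc d * of_real (poly p (Re z))" if z: "cmod z = 1" for z
  proof -
    have "z * cnj z = 1"
      using z complex_norm_square[of z] by simp
    then have "(1 + z * z) / 2 = z * ((z + cnj z) / 2)"
      by (simp add: algebra_simps)
    then have "(1 + z * z) / 2 = z * of_real (Re z)"
      by (simp add: complex_add_cnj)
    then have "(1 + z * z) / 2 * (z ^ d * of_real (poly p' (Re z))) =
        z ^ Suc d * (of_real (Re z) * of_real (poly p' (Re z)))"
      by simp
    then show ?thesis
      using q(2)[OF z] by (simp add: p poly_monom algebra_simps)
  qed
  moreover have "cpev u ?q = u ^ Suc d * pev h p"
  proof -
    have "cpev u ?q = a *\<^sub>R u ^ Suc d + (1/2::real) *\<^sub>R ((u * u + 1) * (u ^ d * pev h p'))"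
      by (simp add: cpev_add cpev_smult cpev_monom q(3) scaleR_eq_scaleC algebra_simps)
    also have "(u * u + 1) * (u ^ d * pev h p') = 2 *\<^sub>R (h * u * (u ^ d * pev h p'))"
      by (simp add: u(1))
    also have "h * u * (u ^ d * pev h p') = u ^ Suc d * (h * pev h p')"
      using power_commuting_commutes[of u h "Suc d"] u(2) by (simp add: mult.assoc[symmetric])
    finally show ?thesis
      by (simp add: p algebra_simps of_real_def)
  qed
  ultimately show ?case
    by blast
qed

text \<open>Multiplying \<open>p h\<close> by a power of \<open>u\<close> gives a polynomial in \<open>u\<close>, whose coefficients are
  bounded by Cauchy's estimate. The factor growing linearly in the degree is removed below by the
  spectral radius argument.\<close>

lemma norm_pev_le_degree:
  fixes h :: "'a::cstar_algebra_1"
  assumes "norm h < 1" "star h = h" "\<And>t. \<bar>t\<bar> \<le> 1 \<Longrightarrow> \<bar>poly p t\<bar> \<le> M" "degree p \<le> d"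
  shows "norm (pev h p) \<le> (2 * real d + 1) * M"
proof -
  obtain u where u: "star u * u = 1" "u * u + 1 = 2 *\<^sub>R (h * u)" "u * h = h * u"
    using unitary_with_real_part assms(1,2) .
  obtain q where q: "degree q \<le> 2 * d"
      "\<And>z. cmod z = 1 \<Longrightarrow> poly q z = z ^ d * of_real (poly p (Re z))"
      "cpev u q = u ^ d * pev h p"
    using poly_in_real_part[OF u(2,3) assms(4)] by blast
  have nu: "norm u = 1"
    using cstar_identity[of u] norm_ge_zero[of u] by (simp add: u(1) power2_eq_1_iff[of "norm u"])
  have "cmod (poly q z) \<le> M" if "cmod z = 1" for z
    using that abs_Re_le_cmod[of z] by (simp add: q(2) norm_mult norm_power assms(3))
  then have "norm (cpev u q) \<le> (real (2 * d) + 1) * M"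
    by (intro norm_cpev_le coeff_bound_unit_circle) (simp_all add: nu q(1))
  moreover have "star u ^ n * u ^ n = 1" for n
  proof (induction n)
    case (Suc n)
    have "star u ^ Suc n * u ^ Suc n = star u ^ n * (star u * u) * u ^ n"
      by (simp add: power_Suc2 mult.assoc del: power_Suc) (simp add: power_commutes)
    then show ?case
      by (simp add: u(1) Suc)
  qed simp
  then have "pev h p = star u ^ d * cpev u q"
    by (simp add: q(3) flip: mult.assoc)
  then have "norm (pev h p) \<le> norm u ^ d * norm (cpev u q)"
    using norm_mult_ineq[of "star u ^ d" "cpev u q"]
      mult_right_mono[OF norm_power_ineq[of "star u" d] norm_ge_zero[of "cpev u q"]]
    by simp
  ultimately show ?thesis
    by (simp add: nu)
qed

text \<open>The iterated C*-identity: along powers of two the spectral radius formula is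
  exact.\<close>

lemma norm_power_two_self_adjoint:
  "star x = x \<Longrightarrow> norm (x ^ (2 ^ n)) = norm (x::'a::cstar_algebra_1) ^ (2 ^ n)"
proof (induction n)
  case (Suc n)
  have "norm (x ^ (2 ^ Suc n)) = norm (star (x ^ (2 ^ n)) * x ^ (2 ^ n))"
    by (simp add: star_power Suc.prems mult_2 power_add)
  also have "\<dots> = norm x ^ (2 ^ Suc n)"
    by (simp only: cstar_identity Suc.IH[OF Suc.prems] power_mult[symmetric] power_Suc2)
  finally show ?case .
qed simp

text \<open>The weak bound is applied to \<open>p ^ (2 ^ n)\<close>. If the claim failed, the left
  side would outgrow the right by a factor exponential in \<open>2 ^ n\<close>, whereas the degree
  factor is only linear in \<open>2 ^ n\<close>.\<close>

lemma norm_pev_le_unit: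
  fixes h :: "'a::cstar_algebra_1"
  assumes h: "norm h < 1" "star h = h" and M: "\<And>t. \<bar>t\<bar> \<le> 1 \<Longrightarrow> \<bar>poly p t\<bar> \<le> M"
  shows "norm (pev h p) \<le> M"
proof (rule ccontr)
  assume "\<not> norm (pev h p) \<le> M"
  moreover have "0 \<le> M"
    using M[of 0] by simp
  \<comment> \<open>A value strictly in between is positive, so division by it is possible even if
    \<open>M = 0\<close>.\<close>
  ultimately obtain m where m: "M < m" "m < norm (pev h p)" "0 < m"
    using dense[of M "norm (pev h p)"] by auto
  define r where "r = norm (pev h p) / m"
  define d where "d = degree p"
  have r: "1 < r"
    using m by (simp add: r_def)
  have le: "r ^ (2 ^ n) \<le> 2 * real d * 2 ^ n + 1" for n
  proof -
    have "\<bar>poly (p ^ (2 ^ n)) t\<bar> \<le> m ^ (2 ^ n)" if "\<bar>t\<bar> \<le> 1" for t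
      using M[OF that] m(1) by (simp add: poly_power power_abs power_mono)
    moreover have "degree (p ^ (2 ^ n)) \<le> d * 2 ^ n"
      by (simp add: d_def degree_power_le)
    ultimately have "norm (pev h (p ^ (2 ^ n))) \<le> (2 * real (d * 2 ^ n) + 1) * m ^ (2 ^ n)"
      by (intro norm_pev_le_degree h)
    then have "norm (pev h p) ^ (2 ^ n) \<le> (2 * real (d * 2 ^ n) + 1) * m ^ (2 ^ n)"
      by (simp add: pev_power norm_power_two_self_adjoint star_pev h(2))
    then show ?thesis
      using m(3) by (simp add: r_def power_divide divide_simps mult.assoc)
  qed
  have "(\<lambda>k. (2 * real d * real k + 1) / r ^ k) \<longlonglongrightarrow> 0"
  proof -
    have "(\<lambda>k. 2 * real d * (real k * (1 / r) ^ k) + (1 / r) ^ k) \<longlonglongrightarrow> 2 * real d * 0 + 0"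
      using r by (intro tendsto_intros powser_times_n_limit_0 LIMSEQ_power_zero) auto
    then show ?thesis
      by (simp add: power_divide add_divide_distrib)
  qed
  then have "\<forall>\<^sub>F k in sequentially. (2 * real d * real k + 1) / r ^ k < 1"
    by (rule order_tendstoD) simp
  then obtain N where N: "\<And>k. k \<ge> N \<Longrightarrow> (2 * real d * real k + 1) / r ^ k < 1"
    by (auto simp: eventually_sequentially)
  have "N \<le> 2 ^ N"
    by (simp add: less_imp_le)
  from N[OF this] le[of N] r show False
    by (simp add: divide_less_eq)
qed

text \<open>Rescaling reduces this to the interval from -1 to 1. As the unit case wants a norm
  strictly below 1, \<open>h\<close> is first shrunk by a factor \<open>s < 1\<close>, and
  \<open>s\<close> tends to 1 by continuity.\<close>

proposition norm_pev_le:
  fixes h :: "'a::cstar_algebra_1"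
  assumes h: "norm h \<le> R" "star h = h" and M: "\<And>t. \<bar>t\<bar> \<le> R \<Longrightarrow> \<bar>poly p t\<bar> \<le> M"
  shows "norm (pev h p) \<le> M"
proof -
  have *: "norm (pev (s *\<^sub>R h) p) \<le> M" if s: "0 \<le> s" "s < 1" for s
  proof (cases "R = 0")
    case True
    then show ?thesis
      using norm_pev_le_unit[of 0 "[:poly p 0:]" M] h M[of 0]
      by (cases p) simp
  next
    case False
    then have R: "0 < R"
      using h(1) norm_ge_zero[of h] by linarith
    have "\<bar>poly (pcompose p [:0, R:]) t\<bar> \<le> M" if "\<bar>t\<bar> \<le> 1" for t
      using that R M[of "t * R"] by (simp add: poly_pcompose abs_mult)
    moreover have "s * norm h < R"
      using R s h(1) mult_strict_right_mono[of s 1 R] mult_left_mono[of "norm h" R s] by linarith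
    then have "norm ((s / R) *\<^sub>R h) < 1"
      using R s by simp
    ultimately have "norm (pev ((s / R) *\<^sub>R h) (pcompose p [:0, R:])) \<le> M"
      by (intro norm_pev_le_unit) (simp_all add: star_scaleR h)
    then show ?thesis
      using R by (simp add: pev_pcompose_linear)
  qed
  have "((\<lambda>s. norm (pev (s *\<^sub>R h) p)) \<longlongrightarrow> norm (pev (1 *\<^sub>R h) p)) (at_left 1)"
    by (intro tendsto_norm isCont_tendsto_compose[OF continuous_pev] tendsto_intros)
  moreover have "\<forall>\<^sub>F s in at_left 1. norm (pev (s *\<^sub>R h) p) \<le> M"
    using eventually_at_left[of 0 "1::real"] * by (metis (mono_tags) less_imp_le zero_less_one)
  ultimately show ?thesis
    using tendsto_upperbound trivial_limit_at_left_real by fastforce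
qed

section \<open>From polynomials to continuous functions\<close>

lemma poly_fun_simps:
  "poly (p + q) = (\<lambda>t. poly p t + poly q t)" "poly (p - q) = (\<lambda>t. poly p t - poly q t)"
  "poly (p * q) = (\<lambda>t. poly p t * poly q t)" "poly [:c:] = (\<lambda>_. c)" "poly [:0, 1:] = (\<lambda>t::real. t)"
  for p q :: "real poly"
  by (simp_all add: fun_eq_iff)

text \<open>A diagonal choice: the \<open>n\<close>-th polynomial is within
  \<open>1 / (n + 1)\<close> of \<open>f\<close> on the interval from \<open>-n\<close> to
  \<open>n\<close>. Thus one sequence serves every radius.\<close>

lemma polynomial_approximation:
  fixes f :: "real \<Rightarrow> real"
  assumes "continuous_on UNIV f"
  shows "\<exists>P. \<forall>R. uniform_limit {-R..R} (\<lambda>n. poly (P n)) f sequentially"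
proof -
  have "\<exists>p. \<forall>t\<in>{-real n..real n}. \<bar>f t - poly p t\<bar> < inverse (real (Suc n))" for n
  proof -
    obtain g where g: "real_polynomial_function g"
        "\<And>t. t \<in> {-real n..real n} \<Longrightarrow> \<bar>f t - g t\<bar> < inverse (real (Suc n))"
      using Stone_Weierstrass_real_polynomial_function[of "{-real n..real n}" f "inverse (real (Suc n))"]
        continuous_on_subset[OF assms, of "{-real n..real n}"] by auto
    obtain a N where "g = (\<lambda>x. \<Sum>i\<le>N. a i * x ^ i)"
      using g(1) real_polynomial_function_iff_sum by blast
    then have "g t = poly (\<Sum>i\<le>N. monom (a i) i) t" for t
      by (simp add: poly_sum poly_monom)
    then show ?thesis
      using g(2) by (intro exI[of _ "\<Sum>i\<le>N. monom (a i) i"]) simp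
  qed
  then obtain P where P: "\<And>n t. t \<in> {-real n..real n} \<Longrightarrow>
      \<bar>f t - poly (P n) t\<bar> < inverse (real (Suc n))"
    by metis
  have "uniform_limit {-R..R} (\<lambda>n. poly (P n)) f sequentially" for R
  proof (rule uniform_limitI)
    fix e :: real
    assume "e > 0"
    then obtain N where N: "inverse (real (Suc N)) < e"
      using reals_Archimedean by blast
    obtain M where M: "R \<le> real M"
      using real_arch_simple by blast
    have "dist (poly (P n) t) (f t) < e" if "n \<ge> max M N" "t \<in> {-R..R}" for n t
    proof -
      have "inverse (real (Suc n)) \<le> inverse (real (Suc N))"
        using that(1) by (intro le_imp_inverse_le) auto
      moreover have "t \<in> {-real n..real n}"
        using that M by auto
      ultimately show ?thesis
        using P[of t n] N unfolding dist_real_def by linarith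
    qed
    then show "\<forall>\<^sub>F n in sequentially. \<forall>t\<in>{-R..R}. dist (poly (P n) t) (f t) < e"
      unfolding eventually_sequentially by blast
  qed
  then show ?thesis
    by blast
qed

text \<open>Functions are defined on the whole line, so no spectrum is involved. The chosen sequence
  depends on \<open>f\<close> only, hence the same polynomials compute \<open>cfc h f\<close> for
  all self-adjoint \<open>h\<close>.\<close>

definition cfc :: "'a::cstar_algebra_1 \<Rightarrow> (real \<Rightarrow> real) \<Rightarrow> 'a" where
  "cfc h f = lim (\<lambda>n. pev h
    ((SOME P. \<forall>R. uniform_limit {-R..R} (\<lambda>n. poly (P n)) f sequentially) n))"

lemma convergent_pev:
  fixes h :: "'a::cstar_algebra_1"
  assumes h: "star h = h" "norm h \<le> R"
    and P: "uniform_limit {-R..R} (\<lambda>n. poly (P n)) f sequentially"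
  shows "convergent (\<lambda>n. pev h (P n))"
proof (rule Cauchy_convergent, rule metric_CauchyI)
  fix e :: real
  assume "e > 0"
  then have "\<forall>\<^sub>F n in sequentially. \<forall>t\<in>{-R..R}. dist (poly (P n) t) (f t) < e / 3"
    by (intro uniform_limitD[OF P]) simp
  then obtain N where N: "\<And>n t. n \<ge> N \<Longrightarrow> t \<in> {-R..R} \<Longrightarrow> dist (poly (P n) t) (f t) < e / 3"
    unfolding eventually_sequentially by blast
  have "dist (pev h (P m)) (pev h (P n)) < e" if "m \<ge> N" "n \<ge> N" for m n
  proof -
    have "\<bar>poly (P m - P n) t\<bar> \<le> 2 * e / 3" if "\<bar>t\<bar> \<le> R" for t
    proof -
      have "t \<in> {-R..R}"
        using that by (simp add: abs_le_iff)
      from N[OF \<open>m \<ge> N\<close> this] N[OF \<open>n \<ge> N\<close> this] show ?thesis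
        unfolding dist_real_def poly_diff by linarith
    qed
    then have "norm (pev h (P m - P n)) \<le> 2 * e / 3"
      by (rule norm_pev_le[OF h(2,1)])
    then show ?thesis
      using \<open>e > 0\<close> by (simp add: dist_norm pev_diff)
  qed
  then show "\<exists>M. \<forall>m\<ge>M. \<forall>n\<ge>M. dist (pev h (P m)) (pev h (P n)) < e"
    by blast
qed

lemma tendsto_pev_zero:
  fixes h :: "'a::cstar_algebra_1"
  assumes h: "star h = h" "norm h \<le> R"
    and P: "uniform_limit {-R..R} (\<lambda>n. poly (P n)) (\<lambda>_. 0) sequentially"
  shows "(\<lambda>n. pev h (P n)) \<longlonglongrightarrow> 0"
proof (rule tendstoI)
  fix e :: real
  assume "e > 0"
  then have "\<forall>\<^sub>F n in sequentially. \<forall>t\<in>{-R..R}. dist (poly (P n) t) 0 < e / 2"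
    by (intro uniform_limitD[OF P]) simp
  then obtain N where N: "\<And>n t. n \<ge> N \<Longrightarrow> t \<in> {-R..R} \<Longrightarrow> dist (poly (P n) t) 0 < e / 2"
    unfolding eventually_sequentially by blast
  have "norm (pev h (P n)) \<le> e / 2" if "n \<ge> N" for n
  proof (rule norm_pev_le[OF h(2,1)])
    fix t :: real
    assume "\<bar>t\<bar> \<le> R"
    then have "t \<in> {-R..R}"
      by (simp add: abs_le_iff)
    from N[OF that this] show "\<bar>poly (P n) t\<bar> \<le> e / 2"
      by (simp add: dist_real_def)
  qed
  then show "\<forall>\<^sub>F n in sequentially. dist (pev h (P n)) 0 < e"
    using \<open>e > 0\<close> unfolding eventually_sequentially by (intro exI[of _ N]) force
qed

text \<open>Independence of the chosen sequence: two approximating sequences differ by polynomials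
  tending uniformly to 0, whose values at \<open>h\<close> tend to 0 by the norm bound.\<close>

lemma cfc_tendsto:
  fixes h :: "'a::cstar_algebra_1"
  assumes h: "star h = h" "norm h \<le> R" and f: "continuous_on UNIV f"
    and P: "uniform_limit {-R..R} (\<lambda>n. poly (P n)) f sequentially"
  shows "(\<lambda>n. pev h (P n)) \<longlonglongrightarrow> cfc h f"
proof -
  define Q where "Q = (SOME Q. \<forall>R. uniform_limit {-R..R} (\<lambda>n. poly (Q n)) f sequentially)"
  have Q: "uniform_limit {-R..R} (\<lambda>n. poly (Q n)) f sequentially" for R
    using someI_ex[OF polynomial_approximation[OF f]] by (auto simp: Q_def)
  have "(\<lambda>n. pev h (Q n)) \<longlonglongrightarrow> cfc h f"
    using convergent_pev[OF h Q] by (simp add: cfc_def Q_def convergent_LIMSEQ_iff)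
  moreover have "(\<lambda>n. pev h (P n - Q n)) \<longlonglongrightarrow> 0"
    using uniform_limit_minus[OF P Q] by (intro tendsto_pev_zero[OF h]) (simp add: poly_fun_simps)
  ultimately show ?thesis
    using tendsto_add by (fastforce simp: pev_diff)
qed

lemma cfc_approx:
  assumes "continuous_on UNIV f"
  obtains P where "\<And>R. uniform_limit {-R..R} (\<lambda>n. poly (P n)) f sequentially"
    "\<And>h::'a::cstar_algebra_1. star h = h \<Longrightarrow> (\<lambda>n. pev h (P n)) \<longlonglongrightarrow> cfc h f"
  using polynomial_approximation[OF assms] cfc_tendsto[OF _ order_refl assms] by blast

context
  fixes h :: "'a::cstar_algebra_1"
  assumes h: "star h = h"
begin

lemma cfc_poly: "cfc h (poly p) = pev h p"
proof -
  have "(\<lambda>n. pev h p) \<longlonglongrightarrow> cfc h (poly p)"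
    by (rule cfc_tendsto[OF h order_refl]) (auto intro!: continuous_intros uniform_limit_const)
  then show ?thesis
    by (simp add: LIMSEQ_const_iff)
qed

lemma cfc_const: "cfc h (\<lambda>_. c) = of_real c"
  using cfc_poly[of "[:c:]"] by (simp add: poly_fun_simps)

lemma cfc_id: "cfc h (\<lambda>t. t) = h"
  using cfc_poly[of "[:0, 1:]"] by (simp add: poly_fun_simps)

lemma cfc_cong:
  assumes "continuous_on UNIV f" "continuous_on UNIV g" "\<And>t. \<bar>t\<bar> \<le> norm h \<Longrightarrow> f t = g t"
  shows "cfc h f = cfc h g"
proof -
  obtain P where P: "\<And>R. uniform_limit {-R..R} (\<lambda>n. poly (P n)) f sequentially"
      "(\<lambda>n. pev h (P n)) \<longlonglongrightarrow> cfc h f"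
    using cfc_approx[OF assms(1)] h by metis
  have "uniform_limit {-norm h..norm h} (\<lambda>n. poly (P n)) g sequentially
      \<longleftrightarrow> uniform_limit {-norm h..norm h} (\<lambda>n. poly (P n)) f sequentially"
    by (rule uniform_limit_cong) (auto simp: assms(3) abs_le_iff)
  then have "(\<lambda>n. pev h (P n)) \<longlonglongrightarrow> cfc h g"
    using P(1) by (intro cfc_tendsto[OF h order_refl assms(2)]) simp
  then show ?thesis
    using LIMSEQ_unique[OF P(2)] by simp
qed

lemma norm_cfc_le:
  assumes f: "continuous_on UNIV f" and M: "\<And>t. \<bar>t\<bar> \<le> norm h \<Longrightarrow> \<bar>f t\<bar> \<le> M"
  shows "norm (cfc h f) \<le> M"
proof -
  obtain P where P: "\<And>R. uniform_limit {-R..R} (\<lambda>n. poly (P n)) f sequentially"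
      "(\<lambda>n. pev h (P n)) \<longlonglongrightarrow> cfc h f"
    using cfc_approx[OF f] h by metis
  show ?thesis
  proof (rule field_le_epsilon)
    fix e :: real
    assume "e > 0"
    then have "\<forall>\<^sub>F n in sequentially. \<forall>t\<in>{-norm h..norm h}. dist (poly (P n) t) (f t) < e"
      using uniform_limitD[OF P(1)] by blast
    then have "\<forall>\<^sub>F n in sequentially. norm (pev h (P n)) \<le> M + e"
    proof eventually_elim
      case (elim n)
      show ?case
      proof (rule norm_pev_le[OF order_refl h])
        fix t :: real
        assume "\<bar>t\<bar> \<le> norm h"
        then have "t \<in> {-norm h..norm h}" "\<bar>f t\<bar> \<le> M"
          using M by (simp_all add: abs_le_iff)
        then have "dist (poly (P n) t) (f t) < e" "\<bar>f t\<bar> \<le> M"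
          using elim by blast+
        then show "\<bar>poly (P n) t\<bar> \<le> M + e"
          unfolding dist_real_def by linarith
      qed
    qed
    then show "norm (cfc h f) \<le> M + e"
      using tendsto_upperbound[OF tendsto_norm[OF P(2)]] by simp
  qed
qed

lemma star_cfc:
  assumes f: "continuous_on UNIV f"
  shows "star (cfc h f) = cfc h f"
proof -
  obtain P where "(\<lambda>n. pev h (P n)) \<longlonglongrightarrow> cfc h f"
    using cfc_approx[OF f] h by metis
  moreover from this have "(\<lambda>n. star (pev h (P n))) \<longlonglongrightarrow> star (cfc h f)"
    by (rule bounded_linear.tendsto[OF bounded_linear_star])
  ultimately show ?thesis
    using LIMSEQ_unique by (simp add: star_pev[OF h])
qed

lemma cfc_add:
  assumes f: "continuous_on UNIV f" and g: "continuous_on UNIV g"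
  shows "cfc h (\<lambda>t. f t + g t) = cfc h f + cfc h g"
proof -
  obtain P where P: "\<And>R. uniform_limit {-R..R} (\<lambda>n. poly (P n)) f sequentially"
      "(\<lambda>n. pev h (P n)) \<longlonglongrightarrow> cfc h f"
    using cfc_approx[OF f] h by metis
  obtain Q where Q: "\<And>R. uniform_limit {-R..R} (\<lambda>n. poly (Q n)) g sequentially"
      "(\<lambda>n. pev h (Q n)) \<longlonglongrightarrow> cfc h g"
    using cfc_approx[OF g] h by metis
  have "(\<lambda>n. pev h (P n + Q n)) \<longlonglongrightarrow> cfc h (\<lambda>t. f t + g t)"
    using uniform_limit_add[OF P(1) Q(1)] f g
    by (intro cfc_tendsto[OF h order_refl]) (auto simp: poly_fun_simps intro: continuous_intros)
  moreover have "(\<lambda>n. pev h (P n + Q n)) \<longlonglongrightarrow> cfc h f + cfc h g"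
    using tendsto_add[OF P(2) Q(2)] by (simp add: pev_add)
  ultimately show ?thesis
    by (rule LIMSEQ_unique)
qed

lemma cfc_mult:
  assumes f: "continuous_on UNIV f" and g: "continuous_on UNIV g"
  shows "cfc h (\<lambda>t. f t * g t) = cfc h f * cfc h g"
proof -
  obtain P where P: "\<And>R. uniform_limit {-R..R} (\<lambda>n. poly (P n)) f sequentially"
      "(\<lambda>n. pev h (P n)) \<longlonglongrightarrow> cfc h f"
    using cfc_approx[OF f] h by metis
  obtain Q where Q: "\<And>R. uniform_limit {-R..R} (\<lambda>n. poly (Q n)) g sequentially"
      "(\<lambda>n. pev h (Q n)) \<longlonglongrightarrow> cfc h g"
    using cfc_approx[OF g] h by metis
  have "bounded (F ` {-R..R})" if "continuous_on UNIV F" for F :: "real \<Rightarrow> real" and R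
    using compact_continuous_image[OF continuous_on_subset[OF that]] compact_imp_bounded by blast
  then have "uniform_limit {-norm h..norm h} (\<lambda>n. poly (P n * Q n)) (\<lambda>t. f t * g t) sequentially"
    using uniform_lim_mult[OF P(1) Q(1)] f g by (simp add: poly_fun_simps)
  then have "(\<lambda>n. pev h (P n * Q n)) \<longlonglongrightarrow> cfc h (\<lambda>t. f t * g t)"
    using f g by (intro cfc_tendsto[OF h order_refl]) (auto intro: continuous_intros)
  moreover have "(\<lambda>n. pev h (P n * Q n)) \<longlonglongrightarrow> cfc h f * cfc h g"
    using tendsto_mult[OF P(2) Q(2)] by (simp add: pev_mult)
  ultimately show ?thesis
    by (rule LIMSEQ_unique)
qed

lemma cfc_scale:
  assumes f: "continuous_on UNIV f"
  shows "cfc h (\<lambda>t. c * f t) = c *\<^sub>R cfc h f"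
  using cfc_mult[of "\<lambda>_. c" f] f by (simp add: cfc_const) (simp add: of_real_def)

lemma cfc_minus:
  assumes f: "continuous_on UNIV f"
  shows "cfc h (\<lambda>t. - f t) = - cfc h f"
  using cfc_scale[OF f, of "-1"] by simp

lemma cfc_diff:
  assumes f: "continuous_on UNIV f" and g: "continuous_on UNIV g"
  shows "cfc h (\<lambda>t. f t - g t) = cfc h f - cfc h g"
  using cfc_add[OF f, of "\<lambda>t. - g t"] cfc_minus[OF g] g by (simp add: continuous_on_minus)

text \<open>For polynomials this is multiplicativity. In general the error is controlled by how well
  \<open>f\<close> is approximated on the values of \<open>g\<close>.\<close>

lemma cfc_compose:
  assumes f: "continuous_on UNIV f" and g: "continuous_on UNIV g"
  shows "cfc (cfc h g) f = cfc h (\<lambda>t. f (g t))"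
proof -
  obtain P where P: "\<And>R. uniform_limit {-R..R} (\<lambda>n. poly (P n)) f sequentially"
      "(\<lambda>n. pev (cfc h g) (P n)) \<longlonglongrightarrow> cfc (cfc h g) f"
    using cfc_approx[OF f] star_cfc[OF g] by metis
  have cont: "continuous_on UNIV (\<lambda>t. F (g t))" if "continuous_on UNIV F" for F :: "real \<Rightarrow> real"
    using continuous_on_compose2[OF that g] by simp
  have cp: "continuous_on UNIV (\<lambda>t. poly p (g t))" for p
    by (rule cont) (intro continuous_intros)
  have pev: "pev (cfc h g) p = cfc h (\<lambda>t. poly p (g t))" for p
  proof (induction p)
    case 0
    then show ?case
      using cfc_const[of 0] by simp
  next
    case (pCons a p)
    show ?case
      using pCons g cp by (simp add: cfc_add cfc_const cfc_mult continuous_on_mult)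
  qed
  \<comment> \<open>\<open>R\<close> bounds \<open>g\<close> on the interval that matters for
    \<open>h\<close>, so \<open>f\<close> has to be approximated only between \<open>-R\<close> and
    \<open>R\<close>.\<close>
  have "compact (g ` {-norm h..norm h})"
    by (intro compact_continuous_image continuous_on_subset[OF g]) auto
  then obtain R where "\<forall>x\<in>g ` {-norm h..norm h}. norm x \<le> R"
    using compact_imp_bounded bounded_iff by meson
  then have R: "\<And>t. t \<in> {-norm h..norm h} \<Longrightarrow> \<bar>g t\<bar> \<le> R"
    by simp
  have "(\<lambda>n. pev (cfc h g) (P n) - cfc h (\<lambda>t. f (g t))) \<longlonglongrightarrow> 0"
  proof (rule tendstoI)
    fix e :: real
    assume "e > 0"
    then have "\<forall>\<^sub>F n in sequentially. \<forall>t\<in>{-R..R}. dist (poly (P n) t) (f t) < e / 2"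
      using uniform_limitD[OF P(1), of "e / 2"] by simp
    then show "\<forall>\<^sub>F n in sequentially. dist (pev (cfc h g) (P n) - cfc h (\<lambda>t. f (g t))) 0 < e"
    proof eventually_elim
      case (elim n)
      have "norm (cfc h (\<lambda>t. poly (P n) (g t) - f (g t))) \<le> e / 2"
      proof (rule norm_cfc_le)
        show "continuous_on UNIV (\<lambda>t. poly (P n) (g t) - f (g t))"
          by (intro continuous_on_diff cont f poly_isCont continuous_at_imp_continuous_on ballI)
        fix t :: real
        assume "\<bar>t\<bar> \<le> norm h"
        then have "g t \<in> {-R..R}"
          using R[of t] by (auto simp: abs_le_iff)
        then show "\<bar>poly (P n) (g t) - f (g t)\<bar> \<le> e / 2"
          using elim by (force simp: dist_real_def)
      qed
      also have "cfc h (\<lambda>t. poly (P n) (g t) - f (g t)) =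
          pev (cfc h g) (P n) - cfc h (\<lambda>t. f (g t))"
        unfolding pev[of "P n"] by (rule cfc_diff[OF cp cont[OF f]])
      finally show ?case
        using \<open>e > 0\<close> by (simp only: dist_0_norm dist_commute[of _ 0])
    qed
  qed
  then show ?thesis
    by (rule LIMSEQ_unique[OF P(2) LIM_zero_cancel])
qed

text \<open>The congruence \<open>h = m\<close> modulo \<open>V\<close> implies
  \<open>f(h) = f(m)\<close> modulo \<open>V\<close>. With \<open>m = 0\<close> this keeps the
  calculus inside \<open>A\<close> or inside an ideal; with \<open>m = 1\<close> it preserves the
  property of acting as a unit.\<close>

lemma cfc_in_closed_subspace:
  assumes V: "closed V" "0 \<in> V" "\<And>v w. v \<in> V \<Longrightarrow> w \<in> V \<Longrightarrow> v + w \<in> V"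
    "\<And>v r. v \<in> V \<Longrightarrow> r *\<^sub>R v \<in> V" "\<And>v. v \<in> V \<Longrightarrow> v * h \<in> V"
    and m: "h - of_real m \<in> V" and f: "continuous_on UNIV f"
  shows "cfc h f - of_real (f m) \<in> V"
proof -
  have pev: "pev h p - of_real (poly p m) \<in> V" for p
  proof (induction p)
    case (pCons a p)
    have "pev h (pCons a p) - of_real (poly (pCons a p) m) =
        (pev h p - of_real (poly p m)) * h + poly p m *\<^sub>R (h - of_real m)"
      using pev_commute[of h h p] by (simp add: algebra_simps of_real_def)
    then show ?case
      using pCons.IH V m by metis
  qed (simp add: V)
  obtain P where P: "\<And>R. uniform_limit {-R..R} (\<lambda>n. poly (P n)) f sequentially"
      "(\<lambda>n. pev h (P n)) \<longlonglongrightarrow> cfc h f"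
    using cfc_approx[OF f] h by metis
  have "(\<lambda>n. poly (P n) m) \<longlonglongrightarrow> f m"
    by (rule tendsto_uniform_limitI[OF P(1)[of "\<bar>m\<bar>"]]) (simp, linarith)
  then have "(\<lambda>n. of_real (poly (P n) m)) \<longlonglongrightarrow> (of_real (f m) :: 'a)"
    by (rule tendsto_of_real)
  then have "(\<lambda>n. pev h (P n) - of_real (poly (P n) m)) \<longlonglongrightarrow> cfc h f - of_real (f m)"
    using tendsto_diff[OF P(2)] by blast
  then show ?thesis
    by (rule closed_sequentially[OF V(1), rotated]) (rule pev)
qed

end

lemma cfc_intertwine:
  fixes x y z :: "'a::cstar_algebra_1"
  assumes "star x = x" "star z = z" "x * y = y * z" and f: "continuous_on UNIV f"
  shows "cfc x f * y = y * cfc z f"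
proof -
  obtain P where P: "\<And>h::'a. star h = h \<Longrightarrow> (\<lambda>n. pev h (P n)) \<longlonglongrightarrow> cfc h f"
    using cfc_approx[OF f] by metis
  have "(\<lambda>n. pev x (P n) * y) \<longlonglongrightarrow> cfc x f * y" "(\<lambda>n. y * pev z (P n)) \<longlonglongrightarrow> y * cfc z f"
    by (intro tendsto_intros P assms)+
  then show ?thesis
    using LIMSEQ_unique by (simp add: pev_intertwine[OF assms(3)])
qed

section \<open>Positive elements\<close>

text \<open>The condition says that the spectrum of \<open>h\<close> lies in \<open>[0, 2t]\<close>; this form makes closure
  under addition immediate.\<close>

definition cstar_pos :: "'a::cstar_algebra_1 \<Rightarrow> bool" where
  "cstar_pos h \<longleftrightarrow> star h = h \<and> (\<exists>t. norm (of_real t - h) \<le> t)"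

lemma cstar_pos_star: "cstar_pos h \<Longrightarrow> star h = h"
  by (simp add: cstar_pos_def)

lemma cstar_posI: "star h = h \<Longrightarrow> norm (of_real t - h) \<le> t \<Longrightarrow> cstar_pos h"
  by (auto simp: cstar_pos_def)

lemma cstar_pos_zero [simp]: "cstar_pos 0"
  by (rule cstar_posI[of _ 0]) simp_all

lemma cstar_pos_add:
  assumes "cstar_pos h" "cstar_pos k"
  shows "cstar_pos (h + k)"
proof -
  obtain s t where "norm (of_real s - h) \<le> s" "norm (of_real t - k) \<le> t"
    using assms by (auto simp: cstar_pos_def)
  then have "norm (of_real (s + t) - (h + k)) \<le> s + t"
    using norm_triangle_ineq[of "of_real s - h" "of_real t - k"] by (simp add: algebra_simps)
  then show ?thesis
    using assms by (intro cstar_posI[of _ "s + t"]) (auto simp: star_add cstar_pos_star)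
qed

lemma cstar_pos_sum: "(\<And>i. i \<in> A \<Longrightarrow> cstar_pos (f i)) \<Longrightarrow> cstar_pos (sum f A)"
  by (induction A rule: infinite_finite_induct) (auto intro: cstar_pos_add)

lemma cstar_pos_scaleR:
  assumes "cstar_pos h" "0 \<le> r"
  shows "cstar_pos (r *\<^sub>R h)"
proof -
  obtain t where "norm (of_real t - h) \<le> t"
    using assms by (auto simp: cstar_pos_def)
  then have "norm (r *\<^sub>R (of_real t - h)) \<le> r * t"
    using assms(2) by (simp add: mult_left_mono)
  then have "norm (of_real (r * t) - r *\<^sub>R h) \<le> r * t"
    by (simp add: algebra_simps of_real_def)
  then show ?thesis
    using assms by (intro cstar_posI[of _ "r * t"]) (auto simp: star_scaleR cstar_pos_star)
qed

lemma cstar_pos_of_real_diff: "star g = g \<Longrightarrow> norm g \<le> t \<Longrightarrow> cstar_pos (of_real t - g)"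
  by (rule cstar_posI[of _ t]) (simp_all add: star_diff)

lemma cstar_pos_square:
  assumes k: "star k = k"
  shows "cstar_pos (k * k)"
proof (rule cstar_posI)
  have "norm (pev k [:(norm k)\<^sup>2, 0, -1:]) \<le> (norm k)\<^sup>2"
  proof (rule norm_pev_le[OF order_refl k])
    fix t :: real
    assume "\<bar>t\<bar> \<le> norm k"
    then have "t\<^sup>2 \<le> (norm k)\<^sup>2"
      by (simp add: abs_le_square_iff[symmetric])
    then show "\<bar>poly [:(norm k)\<^sup>2, 0, -1:] t\<bar> \<le> (norm k)\<^sup>2"
      by (simp add: power2_eq_square abs_le_iff)
  qed
  then show "norm (of_real ((norm k)\<^sup>2) - k * k) \<le> (norm k)\<^sup>2"
    by simp
qed (simp add: star_mult k)

text \<open>The calculus is applied to \<open>g = t - h\<close> rather than to \<open>h\<close>: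
  since \<open>norm g \<le> t\<close>, the function \<open>t - s\<close> is nonnegative on the whole
  interval relevant to \<open>g\<close>, and its root is available there.\<close>

lemma cstar_pos_sqrt:
  assumes "cstar_pos h"
  obtains k where "star k = k" "k * k = h"
proof -
  obtain t where t: "star h = h" "norm (of_real t - h) \<le> t"
    using assms by (auto simp: cstar_pos_def)
  define g where "g = of_real t - h"
  have g: "star g = g"
    by (simp add: g_def star_diff t)
  define r where "r s = sqrt (max 0 (t - s))" for s
  have r: "continuous_on UNIV r"
    unfolding r_def by (intro continuous_intros)
  have "cfc g r * cfc g r = cfc g (\<lambda>s. r s * r s)"
    by (rule cfc_mult[OF g r r, symmetric])
  also have "\<dots> = cfc g (\<lambda>s. t - s)"
    using t(2) by (intro cfc_cong[OF g] continuous_intros r) (auto simp: r_def g_def)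
  also have "\<dots> = of_real t - g"
    by (subst cfc_diff[OF g]) (auto simp: cfc_const[OF g] cfc_id[OF g] intro: continuous_intros)
  finally show ?thesis
    using that[of "cfc g r"] star_cfc[OF g r] by (simp add: g_def)
qed

lemma cfc_square:
  assumes "star k = k" "continuous_on UNIV f"
  shows "cfc (k * k) f = cfc k (\<lambda>s. f (s * s))"
proof -
  have "cfc k (\<lambda>s. s * s) = k * k"
    by (subst cfc_mult[OF assms(1)]) (auto simp: cfc_id[OF assms(1)] intro: continuous_intros)
  then show ?thesis
    using cfc_compose[OF assms, of "\<lambda>s. s * s"] by (simp add: continuous_on_mult)
qed

text \<open>Writing \<open>h = k * k\<close> replaces \<open>f\<close> by \<open>f (s * s)\<close>,
  which sees only nonnegative arguments. In this way positivity restricts the calculus to the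
  interval from 0 to \<open>norm h\<close>.\<close>

lemma norm_cfc_pos_le:
  assumes h: "cstar_pos h" and f: "continuous_on UNIV f"
    and M: "\<And>t. 0 \<le> t \<Longrightarrow> t \<le> norm h \<Longrightarrow> \<bar>f t\<bar> \<le> M"
  shows "norm (cfc h f) \<le> M"
proof -
  obtain k where k: "star k = k" "k * k = h"
    using cstar_pos_sqrt[OF h] .
  have nk: "(norm k)\<^sup>2 = norm h"
    using cstar_identity[of k] by (simp add: k)
  have "norm (cfc k (\<lambda>s. f (s * s))) \<le> M"
  proof (rule norm_cfc_le[OF k(1)])
    show "continuous_on UNIV (\<lambda>s. f (s * s))"
      by (rule continuous_on_compose2[OF f]) (auto intro: continuous_intros)
    fix s :: real
    assume "\<bar>s\<bar> \<le> norm k"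
    then have "s\<^sup>2 \<le> norm h"
      using nk by (metis abs_le_square_iff abs_norm_cancel)
    then show "\<bar>f (s * s)\<bar> \<le> M"
      by (intro M) (simp_all add: power2_eq_square)
  qed
  then show ?thesis
    using cfc_square[OF k(1) f] by (simp add: k)
qed

lemma cfc_pos_cong:
  assumes h: "cstar_pos h" and f: "continuous_on UNIV f" and g: "continuous_on UNIV g"
    and eq: "\<And>t. 0 \<le> t \<Longrightarrow> t \<le> norm h \<Longrightarrow> f t = g t"
  shows "cfc h f = cfc h g"
proof -
  have "norm (cfc h (\<lambda>t. f t - g t)) \<le> 0"
    using eq f g by (intro norm_cfc_pos_le[OF h]) (auto intro: continuous_intros)
  then show ?thesis
    using cfc_diff[OF cstar_pos_star[OF h] f g] by simp
qed

lemma cfc_of_real_diff: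
  assumes "star h = h" "continuous_on UNIV f"
  shows "cfc (of_real t - h) f = cfc h (\<lambda>s. f (t - s))"
proof -
  have "cfc h (\<lambda>s. t - s) = of_real t - h"
    by (subst cfc_diff[OF assms(1)])
      (auto simp: cfc_id[OF assms(1)] cfc_const[OF assms(1)] intro: continuous_intros)
  then show ?thesis
    using cfc_compose[OF assms, of "\<lambda>s. t - s"] by (simp add: continuous_on_diff)
qed

text \<open>The part of \<open>h\<close> above \<open>t\<close> is the negative part of
  \<open>t - h\<close>, hence zero. So \<open>h\<close> equals its truncation at
  \<open>t\<close>.\<close>

lemma norm_le_of_pos:
  assumes h: "cstar_pos h" and k: "cstar_pos (of_real t - h)" and t: "0 \<le> t"
  shows "norm h \<le> t"
proof -
  have sa: "star h = h"
    by (rule cstar_pos_star[OF h])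
  have c: "continuous_on UNIV (\<lambda>s. max 0 (s - t))" "continuous_on UNIV (\<lambda>s. min s t)"
    "continuous_on UNIV (\<lambda>s. max 0 (- s) :: real)"
    by (intro continuous_intros)+
  have "cfc h (\<lambda>s. max 0 (s - t)) = cfc (of_real t - h) (\<lambda>s. max 0 (- s))"
    by (simp add: cfc_of_real_diff[OF sa c(3)])
  also have "\<dots> = cfc (of_real t - h) (\<lambda>_. 0)"
    by (rule cfc_pos_cong[OF k c(3)]) auto
  also have "\<dots> = 0"
    using cfc_const[OF cstar_pos_star[OF k], of 0] by simp
  finally have "cfc h (\<lambda>s. max 0 (s - t) + min s t) = cfc h (\<lambda>s. min s t)"
    by (simp add: cfc_add[OF sa c(1,2)])
  moreover have "(\<lambda>s. max 0 (s - t) + min s t) = (\<lambda>s. s)"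
    by auto
  ultimately have "h = cfc h (\<lambda>s. min s t)"
    by (simp add: cfc_id[OF sa])
  also have "norm \<dots> \<le> t"
    using t by (intro norm_cfc_pos_le[OF h c(2)]) auto
  finally show ?thesis .
qed

lemma norm_mono_pos:
  assumes h: "cstar_pos h" and k: "cstar_pos (k - h)"
  shows "norm h \<le> norm k"
proof (rule norm_le_of_pos[OF h])
  have "star k = k"
    using cstar_pos_star[OF cstar_pos_add[OF h k]] by simp
  then have "cstar_pos ((of_real (norm k) - k) + (k - h))"
    by (intro cstar_pos_add cstar_pos_of_real_diff k) auto
  then show "cstar_pos (of_real (norm k) - h)"
    by simp
qed simp

text \<open>With \<open>v\<close> the negative part of \<open>h = x\<^sup>* x\<close> and \<open>y = x v\<close>, both \<open>- y\<^sup>* y\<close> and \<open>y y\<^sup>*\<close> are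
  positive. As \<open>\<bar>y y\<^sup>*\<bar> y = y \<bar>y\<^sup>* y\<bar>\<close>, this forces \<open>y = 0\<close>.\<close>

lemma eq_zero_of_neg_star_mult_pos:
  fixes y :: "'a::cstar_algebra_1"
  assumes neg: "cstar_pos (- (star y * y))"
  shows "star y * y = 0"
proof -
  \<comment> \<open>\<open>a\<close> and \<open>b\<close> are, up to sign, twice the real and
    imaginary parts of \<open>y\<close>. Their squares add up to twice
    \<open>star y * y + y * star y\<close>, which yields positivity of
    \<open>y * star y\<close>.\<close>
  define a where "a = y + star y"
  define b where "b = \<i> *\<^sub>C (y - star y)"
  have "cstar_pos (a * a + b * b)"
    by (intro cstar_pos_add cstar_pos_square)
      (simp_all add: a_def b_def star_add star_diff star_scaleC star_star add.commute
        scaleC_minus_left scaleC_diff_right)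
  moreover have "a * a + b * b = 2 *\<^sub>R (star y * y + y * star y)"
    by (simp add: a_def b_def algebra_simps mult_scaleC_left mult_scaleC_right scaleC_scaleC
        scaleC_minus_left scaleC_diff_right scaleC_add_right scaleR_2)
  ultimately have "cstar_pos ((1/2) *\<^sub>R (2 *\<^sub>R (star y * y + y * star y)) + - (star y * y))"
    by (intro cstar_pos_add[OF cstar_pos_scaleR neg]) auto
  then have pos: "cstar_pos (y * star y)"
    by simp
  have ab: "continuous_on UNIV (abs :: real \<Rightarrow> real)"
    by (intro continuous_intros)
  have "cfc h abs = h" if "cstar_pos h" for h :: 'a
    using cfc_pos_cong[OF that ab, of "\<lambda>s. s"] cfc_id[OF cstar_pos_star[OF that]] by auto
  note abs = this[OF pos] this[OF neg]
  have sa: "star (star y * y) = star y * y"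
    by (simp add: star_mult star_star)
  have "cfc (star y * y) abs = - (star y * y)"
    using cfc_of_real_diff[OF sa ab, of 0] abs(2) by simp
  moreover have "cfc (y * star y) abs * y = y * cfc (star y * y) abs"
    by (rule cfc_intertwine) (simp_all add: star_mult star_star mult.assoc ab)
  ultimately have "y * star y * y = - (y * star y * y)"
    using abs(1) by (simp add: mult.assoc)
  then have "y * star y * y = 0"
    by (simp add: eq_neg_iff_add_eq_0 flip: scaleR_2)
  then have "star (star y * y) * (star y * y) = 0"
    by (simp add: sa mult.assoc)
  then show ?thesis
    by (simp only: star_mult_self_eq_zero_iff)
qed

proposition cstar_pos_star_mult: "cstar_pos (star x * x)"
proof -
  define h where "h = star x * x"
  have h: "star h = h"
    by (simp add: h_def star_mult star_star)
  \<comment> \<open>\<open>n\<close> is the negative part, \<open>p\<close> the root of the positive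
    part. \<open>r\<close> is \<open>n\<close> to the power 3/2, so that
    \<open>n t * t * n t\<close>, which is minus the cube of \<open>n t\<close>, becomes minus a
    square.\<close>
  define n p r :: "real \<Rightarrow> real" where "n t = max 0 (- t)" and "p t = sqrt (max 0 t)"
    and "r t = sqrt (n t) * n t" for t
  have c: "continuous_on UNIV n" "continuous_on UNIV p" "continuous_on UNIV r"
    unfolding n_def p_def r_def by (intro continuous_intros)+
  define v where "v = cfc h n"
  have v: "star v = v"
    by (simp add: v_def star_cfc[OF h c(1)])
  have "star (x * v) * (x * v) = v * h * v"
    by (simp add: star_mult v h_def mult.assoc)
  also have "\<dots> = cfc h (\<lambda>t. n t * t * n t)"
    by (simp add: cfc_mult[OF h] c cfc_id[OF h] v_def continuous_on_mult)
  finally have y: "star (x * v) * (x * v) = cfc h (\<lambda>t. n t * t * n t)" .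
  also have "\<dots> = - cfc h (\<lambda>t. r t * r t)"
  proof -
    have "n t * t * n t = - (r t * r t)" for t
    proof -
      have "r t * r t = (sqrt (n t) * sqrt (n t)) * (n t * n t)"
        by (simp only: r_def mult_ac)
      also have "sqrt (n t) * sqrt (n t) = n t"
        by (simp add: n_def)
      finally show ?thesis
        by (simp add: n_def max_def)
    qed
    then show ?thesis
      using c(3) by (simp add: cfc_minus[OF h] continuous_on_mult)
  qed
  finally have "- (star (x * v) * (x * v)) = cfc h r * cfc h r"
    by (simp add: cfc_mult[OF h c(3,3)])
  then have "cstar_pos (- (star (x * v) * (x * v)))"
    by (simp add: cstar_pos_square star_cfc[OF h c(3)])
  then have "star (x * v) * (x * v) = 0"
    by (rule eq_zero_of_neg_star_mult_pos)
  then have "0 = - cfc h (\<lambda>t. n t * t * n t)"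
    using y by simp
  also have "\<dots> = cfc h (\<lambda>t. - (n t * t * n t))"
    using c by (intro cfc_minus[OF h, symmetric] continuous_intros)
  also have "(\<lambda>t. - (n t * t * n t)) = (\<lambda>t. n t * n t * n t)"
    by (auto simp: n_def max_def)
  also have "cfc h (\<lambda>t. n t * n t * n t) = v * v * v"
    using c by (simp add: cfc_mult[OF h] v_def continuous_on_mult)
  finally have "v * v * v = 0"
    by simp
  then have "star (v * v) * (v * v) = 0"
    by (simp add: star_mult v mult.assoc)
  then have "v = 0"
    using star_mult_self_eq_zero_iff[of "v * v"] star_mult_self_eq_zero_iff[of v] v by simp
  have "(\<lambda>t. max 0 t - n t) = (\<lambda>t. t)"
    by (auto simp: n_def max_def)
  then have "h = cfc h (\<lambda>t. max 0 t - n t)"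
    by (simp add: cfc_id[OF h])
  also have "\<dots> = cfc h (\<lambda>t. max 0 t) - v"
    unfolding v_def by (intro cfc_diff[OF h _ c(1)] continuous_intros)
  also have "\<dots> = cfc h (\<lambda>t. p t * p t)"
    by (simp add: \<open>v = 0\<close> p_def)
  also have "\<dots> = cfc h p * cfc h p"
    by (rule cfc_mult[OF h c(2,2)])
  finally have "h = cfc h p * cfc h p" .
  moreover have "cstar_pos (cfc h p * cfc h p)"
    by (rule cstar_pos_square[OF star_cfc[OF h c(2)]])
  ultimately show ?thesis
    unfolding h_def by metis
qed

lemma cstar_pos_conj:
  assumes "cstar_pos h"
  shows "cstar_pos (star x * h * x)"
proof -
  obtain k where "star k = k" "k * k = h"
    using cstar_pos_sqrt[OF assms] .
  then have "star x * h * x = star (k * x) * (k * x)"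
    by (metis mult.assoc star_mult)
  then show ?thesis
    by (simp add: cstar_pos_star_mult)
qed

text \<open>The radius \<open>t\<close> in \<open>cstar_pos\<close> may vary along the sequence. For
  a positive element every \<open>T\<close> above its norm is admissible, so a common norm bound
  serves as a common radius.\<close>

lemma cstar_pos_limit:
  assumes lim: "X \<longlonglongrightarrow> h" and pos: "\<And>n. cstar_pos (X n)"
  shows "cstar_pos h"
proof -
  obtain T where T: "\<And>n. norm (X n) \<le> T"
    using lim Bseq_def convergent_def convergent_imp_Bseq by metis
  have "norm (of_real T - X n) \<le> T" for n
  proof -
    have "0 \<le> T"
      using T[of 0] norm_ge_zero order_trans by blast
    have "cfc (X n) (\<lambda>s. T - s) = of_real T - X n"
      by (subst cfc_diff[OF cstar_pos_star[OF pos]])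
        (auto simp: cfc_const[OF cstar_pos_star[OF pos]] cfc_id[OF cstar_pos_star[OF pos]]
          intro: continuous_intros)
    moreover have "norm (cfc (X n) (\<lambda>s. T - s)) \<le> T"
      using T[of n] by (intro norm_cfc_pos_le[OF pos] continuous_intros) auto
    ultimately show ?thesis
      by simp
  qed
  then have "norm (of_real T - h) \<le> T"
    by (intro LIMSEQ_le_const2[OF tendsto_norm[OF tendsto_diff[OF tendsto_const lim]]]) auto
  moreover have "star h = h"
    using LIMSEQ_unique[OF bounded_linear.tendsto[OF bounded_linear_star lim], of h] lim
    by (simp add: cstar_pos_star[OF pos])
  ultimately show ?thesis
    by (intro cstar_posI)
qed

section \<open>Functional calculus in nonunital algebras and closed ideals\<close>

lemma closed_scal_zero: "closed {z :: 'a::cstar_algebra unitization. scal z = 0}"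
  by (intro closed_Collect_eq continuous_intros
      bounded_linear.continuous_on[OF bounded_linear_scal])

lemma scal_cfc_emb:
  fixes h :: "'a::cstar_algebra"
  assumes "star h = h" "continuous_on UNIV f" "f 0 = 0"
  shows "scal (cfc (emb h) f) = 0"
proof -
  have "cfc (emb h) f - of_real (f 0) \<in> {z. scal z = 0}"
    by (rule cfc_in_closed_subspace) (simp_all add: closed_scal_zero assms flip: emb_star)
  then show ?thesis
    by (simp add: assms)
qed

text \<open>Positivity in \<open>A\<close> and in the unitization agree: the root of
  \<open>emb a\<close> has scalar part 0 because the root function vanishes at 0, and therefore
  comes from \<open>A\<close>.\<close>

lemma positives_iff: "a \<in> positives \<longleftrightarrow> cstar_pos (emb a)"
proof
  assume "a \<in> positives"
  then show "cstar_pos (emb a)"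
    by (auto simp: positives_def emb_simps emb_star cstar_pos_star_mult)
next
  assume pos: "cstar_pos (emb a)"
  let ?k = "cfc (emb a) (\<lambda>t. sqrt \<bar>t\<bar>)"
  have c: "continuous_on UNIV (\<lambda>t::real. sqrt \<bar>t\<bar>)"
    by (intro continuous_intros)
  note sa = cstar_pos_star[OF pos]
  then have "star a = a"
    by (simp flip: emb_star)
  then have k: "emb (alg ?k) = ?k"
    by (intro emb_alg scal_cfc_emb c) simp_all
  have "?k * ?k = cfc (emb a) (\<lambda>t. \<bar>t\<bar>)"
    by (subst cfc_mult[OF sa c c, symmetric]) simp
  also have "\<dots> = emb a"
    using cfc_pos_cong[OF pos, of "\<lambda>t. \<bar>t\<bar>" "\<lambda>t. t"] cfc_id[OF sa]
    by (simp add: continuous_on_rabs)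
  finally have "emb (star (alg ?k) * alg ?k) = emb a"
    by (simp add: emb_simps emb_star k star_cfc[OF sa c])
  then have "a = star (alg ?k) * alg ?k"
    by (simp only: emb_eq_iff)
  then show "a \<in> positives"
    unfolding positives_def by blast
qed

lemma positives_star: "a \<in> positives \<Longrightarrow> star a = a"
  by (auto simp: positives_def star_mult star_star)

lemma positives_add: "a \<in> positives \<Longrightarrow> b \<in> positives \<Longrightarrow> a + b \<in> positives"
  by (simp add: positives_iff emb_simps cstar_pos_add)

section \<open>Closed ideals: functional calculus, heredity, self-adjointness\<close>

context
  fixes I :: "'a::cstar_algebra set"
  assumes I: "closed_ideal I"
begin

lemma ideal_zero: "0 \<in> I"
  and ideal_add: "x \<in> I \<Longrightarrow> y \<in> I \<Longrightarrow> x + y \<in> I"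
  and ideal_scaleC: "x \<in> I \<Longrightarrow> c *\<^sub>C x \<in> I"
  and ideal_mult_left: "x \<in> I \<Longrightarrow> a * x \<in> I"
  and ideal_mult_right: "x \<in> I \<Longrightarrow> x * a \<in> I"
  and ideal_closed: "closed I"
  using I by (auto simp: closed_ideal_def)

lemma ideal_scaleR: "x \<in> I \<Longrightarrow> r *\<^sub>R x \<in> I"
  by (simp add: scaleR_eq_scaleC ideal_scaleC)

lemma ideal_minus: "x \<in> I \<Longrightarrow> - x \<in> I"
  using ideal_scaleR[of x "-1"] by simp

lemma ideal_diff: "x \<in> I \<Longrightarrow> y \<in> I \<Longrightarrow> x - y \<in> I"
  using ideal_add[of x "- y"] ideal_minus by simp

lemma ideal_sum: "(\<And>i. i \<in> A \<Longrightarrow> f i \<in> I) \<Longrightarrow> sum f A \<in> I"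
  by (induction A rule: infinite_finite_induct) (auto intro: ideal_zero ideal_add)

lemma ideal_suminf: "summable f \<Longrightarrow> (\<And>k. f k \<in> I) \<Longrightarrow> suminf f \<in> I"
  by (rule closed_sequentially[OF ideal_closed _ summable_LIMSEQ]) (auto intro: ideal_sum)

lemma cfc_emb_in_ideal:
  assumes h: "h \<in> I" "star h = h" and f: "continuous_on UNIV f" "f 0 = 0"
  shows "alg (cfc (emb h) f) \<in> I"
proof -
  have cl: "closed (emb ` I)"
    unfolding closed_sequential_limits
  proof safe
    fix X z
    assume X: "\<forall>n. X n \<in> emb ` I" and lim: "X \<longlonglongrightarrow> z"
    have "X n \<in> {z. scal z = 0}" for n
      using X[rule_format, of n] by auto
    then have "z \<in> {z. scal z = 0}"
      using lim by (rule closed_sequentially[OF closed_scal_zero])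
    then have "scal z = 0"
      by simp
    then have z: "emb (alg z) = z"
      by (rule emb_alg)
    have "emb (alg (X n)) = X n" for n
      using X[rule_format, of n] by auto
    then have "norm (alg (X n) - alg z) = norm (X n - z)" for n
      by (metis emb_simps(2) norm_emb z)
    then have "(\<lambda>n. alg (X n)) \<longlonglongrightarrow> alg z"
      using lim by (simp add: tendsto_iff dist_norm)
    moreover have "alg (X n) \<in> I" for n
      using X[rule_format, of n] by auto
    ultimately have "alg z \<in> I"
      by (rule closed_sequentially[OF ideal_closed, rotated])
    then show "z \<in> emb ` I"
      using z by (metis imageI)
  qed
  have mem: "emb a \<in> emb ` I \<longleftrightarrow> a \<in> I" for a
    by auto
  have "cfc (emb h) f - of_real (f 0) \<in> emb ` I"
  proof (rule cfc_in_closed_subspace)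
    show "closed (emb ` I)"
      by (rule cl)
    show "star (emb h) = emb h"
      by (simp add: h flip: emb_star)
    show "0 \<in> emb ` I"
      using mem[of 0] by (simp add: emb_simps ideal_zero)
    show "v + w \<in> emb ` I" if "v \<in> emb ` I" "w \<in> emb ` I" for v w
      using that by (auto simp: mem ideal_add simp flip: emb_simps(1))
    show "r *\<^sub>R v \<in> emb ` I" if "v \<in> emb ` I" for v r
      using that by (auto simp: mem ideal_scaleR simp flip: emb_simps(4))
    show "v * emb h \<in> emb ` I" if "v \<in> emb ` I" for v
      using that by (auto simp: mem ideal_mult_right simp flip: emb_simps(3))
  qed (use h f in simp_all)
  then show ?thesis
    using f(2) by auto
qed

text \<open>The elements \<open>x f\<^sub>n(s)\<close> with \<open>f\<^sub>n t = min 1 (n t)\<close> lie in the ideal and converge to \<open>x\<close>,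
  because \<open>t (1 - f\<^sub>n t)\<^sup>2 \<le> 1 / n\<close>.\<close>

proposition ideal_hereditary:
  assumes s: "s \<in> I" and pos: "cstar_pos (emb s - star (emb x) * emb x)"
  shows "x \<in> I"
proof -
  have "cstar_pos ((emb s - star (emb x) * emb x) + star (emb x) * emb x)"
    by (rule cstar_pos_add[OF pos cstar_pos_star_mult])
  then have ps: "cstar_pos (emb s)"
    by simp
  note sa = cstar_pos_star[OF ps]
  then have sa': "star s = s"
    by (simp flip: emb_star)
  define f :: "nat \<Rightarrow> real \<Rightarrow> real" where "f n t = min 1 (real (Suc n) * \<bar>t\<bar>)" for n t
  have cf: "continuous_on UNIV (f n)" for n
    unfolding f_def by (intro continuous_intros)
  define u where "u n = alg (cfc (emb s) (f n))" for n
  have u: "u n \<in> I" "emb (u n) = cfc (emb s) (f n)" for n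
    using cfc_emb_in_ideal[OF s sa' cf] emb_alg[OF scal_cfc_emb[OF sa' cf]]
    by (simp_all add: u_def f_def)
  have le: "(norm (x - x * u n))\<^sup>2 \<le> inverse (real (Suc n))" for n
  proof -
    define w where "w = 1 - emb (u n)"
    have cw: "continuous_on UNIV (\<lambda>t. 1 - f n t)"
      by (intro continuous_intros cf)
    have w: "w = cfc (emb s) (\<lambda>t. 1 - f n t)"
      unfolding w_def u(2) by (subst cfc_diff[OF sa _ cf]) (auto simp: cfc_const[OF sa] intro: continuous_intros)
    then have sw: "star w = w"
      by (simp add: star_cfc[OF sa cw])
    have "emb (x - x * u n) = emb x * w"
      by (simp add: w_def emb_simps algebra_simps)
    then have "(norm (x - x * u n))\<^sup>2 = norm (star w * (star (emb x) * emb x) * w)"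
      by (metis cstar_identity mult.assoc norm_emb star_mult)
    also have "\<dots> \<le> norm (star w * emb s * w)"
    proof (rule norm_mono_pos)
      show "cstar_pos (star w * (star (emb x) * emb x) * w)"
        by (intro cstar_pos_conj cstar_pos_star_mult)
      show "cstar_pos (star w * emb s * w - star w * (star (emb x) * emb x) * w)"
        using cstar_pos_conj[OF pos, of w] by (simp add: algebra_simps)
    qed
    also have "star w * emb s * w = cfc (emb s) (\<lambda>t. (1 - f n t) * t * (1 - f n t))"
      unfolding sw unfolding w by (simp add: cw cfc_mult[OF sa] cfc_id[OF sa] continuous_on_mult)
    also have "norm \<dots> \<le> inverse (real (Suc n))"
    proof (rule norm_cfc_pos_le[OF ps])
      show "continuous_on UNIV (\<lambda>t. (1 - f n t) * t * (1 - f n t))"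
        by (intro continuous_intros cf)
      fix t :: real
      assume t: "0 \<le> t"
      show "\<bar>(1 - f n t) * t * (1 - f n t)\<bar> \<le> inverse (real (Suc n))"
      proof (cases "real (Suc n) * t \<le> 1")
        case True
        then have "0 \<le> 1 - f n t" "1 - f n t \<le> 1" "t \<le> inverse (real (Suc n))"
          using t by (auto simp: f_def field_simps)
        then have "(1 - f n t) * t * (1 - f n t) \<le> 1 * inverse (real (Suc n)) * 1"
          using t by (intro mult_mono) auto
        then show ?thesis
          using t by (simp add: abs_mult mult.assoc)
      next
        case False
        then have "f n t = 1"
          using t by (simp add: f_def)
        then show ?thesis
          by simp
      qed
    qed
    finally show ?thesis .
  qed
  have "(\<lambda>n. (norm (x - x * u n))\<^sup>2) \<longlonglongrightarrow> 0"
    using le by (intro tendsto_sandwich[OF _ _ tendsto_const LIMSEQ_inverse_real_of_nat]) auto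
  then have "(\<lambda>n. sqrt ((norm (x - x * u n))\<^sup>2)) \<longlonglongrightarrow> sqrt 0"
    by (rule tendsto_real_sqrt)
  then have "(\<lambda>n. x - x * u n) \<longlonglongrightarrow> 0"
    by (simp add: tendsto_norm_zero_iff)
  then have "(\<lambda>n. x - (x - x * u n)) \<longlonglongrightarrow> x - 0"
    by (intro tendsto_intros)
  then show ?thesis
    using closed_sequentially[OF ideal_closed, of "\<lambda>n. x * u n"] u(1) ideal_mult_left by simp
qed

lemma ideal_star_mult_self:
  assumes "star x * x \<in> I"
  shows "x \<in> I"
  by (rule ideal_hereditary[OF assms]) (simp add: emb_simps emb_star)

text \<open>Self-adjointness is derived, not assumed: the square \<open>x * star x\<close> of
  \<open>star x\<close> is in the ideal, and heredity takes the root.\<close>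

lemma ideal_star:
  assumes "x \<in> I"
  shows "star x \<in> I"
  by (rule ideal_star_mult_self) (simp add: star_star ideal_mult_right assms)

end

lemma cfc_emb_positive:
  fixes a c :: "'a::cstar_algebra"
  assumes c: "c \<in> positives" and f: "continuous_on UNIV f" "f 0 = 0" "\<And>t. 0 \<le> f t"
  shows "alg (cfc (emb c) f) \<in> positives"
proof -
  have cr: "continuous_on UNIV (\<lambda>t. sqrt (f t))"
    by (intro continuous_intros f)
  have sa: "star c = c" "star (emb c) = emb c"
    using positives_star[OF c] by (simp_all flip: emb_star)
  have "cfc (emb c) f = cfc (emb c) (\<lambda>t. sqrt (f t)) * cfc (emb c) (\<lambda>t. sqrt (f t))"
    using f(3) by (simp flip: cfc_mult[OF sa(2) cr cr])
  then have "cstar_pos (cfc (emb c) f)"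
    by (simp add: cstar_pos_square star_cfc[OF sa(2) cr])
  then show ?thesis
    by (simp add: positives_iff emb_alg scal_cfc_emb[OF sa(1) f(1,2)])
qed

section \<open>The standard Hilbert module\<close>

lemma norm_sum_star_mult_mono:
  fixes x :: "'i \<Rightarrow> 'a::cstar_algebra"
  assumes "finite B" "A \<subseteq> B"
  shows "norm (\<Sum>i\<in>A. star (x i) * x i) \<le> norm (\<Sum>i\<in>B. star (x i) * x i)"
proof -
  let ?s = "\<lambda>A. \<Sum>i\<in>A. star (emb (x i)) * emb (x i)"
  have "?s B - ?s A = ?s (B - A)"
    using sum_diff[OF assms, of "\<lambda>i. star (emb (x i)) * emb (x i)"] by simp
  then have "norm (?s A) \<le> norm (?s B)"
    by (intro norm_mono_pos) (simp_all add: cstar_pos_sum cstar_pos_star_mult)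
  moreover have "?s A = emb (\<Sum>i\<in>A. star (x i) * x i)" for A
    by (simp add: emb_sum emb_simps emb_star)
  ultimately show ?thesis
    by simp
qed

text \<open>Expand \<open>\<Sum>\<^sub>i z\<^sub>i\<^sup>* z\<^sub>i \<ge> 0\<close> for \<open>z\<^sub>i = x\<^sub>i k / c - y\<^sub>i\<close>, where \<open>k = \<Sum>\<^sub>i x\<^sub>i\<^sup>* y\<^sub>i\<close> and
  \<open>c\<close> is the norm of \<open>\<Sum>\<^sub>i x\<^sub>i\<^sup>* x\<^sub>i\<close>.\<close>

lemma Cauchy_Schwarz_unital:
  fixes x y :: "'i \<Rightarrow> 'a::cstar_algebra_1"
  assumes c: "norm (\<Sum>i\<in>A. star (x i) * x i) = c" "c > 0"
  shows "(norm (\<Sum>i\<in>A. star (x i) * y i))\<^sup>2 \<le> c * norm (\<Sum>i\<in>A. star (y i) * y i)"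
proof -
  define g where "g = (\<Sum>i\<in>A. star (x i) * x i)"
  define h where "h = (\<Sum>i\<in>A. star (y i) * y i)"
  define k where "k = (\<Sum>i\<in>A. star (x i) * y i)"
  define r where "r = 1 / c"
  have r: "r > 0" "r * c = 1"
    using c(2) by (simp_all add: r_def)
  have sk: "star k = (\<Sum>i\<in>A. star (y i) * x i)"
    by (simp add: k_def star_sum star_mult star_star)
  have sg: "star g = g"
    by (simp add: g_def star_sum star_mult star_star)
  have sums: "(\<Sum>i\<in>A. r\<^sup>2 *\<^sub>R (star k * (star (x i) * x i) * k)) = r\<^sup>2 *\<^sub>R (star k * g * k)"
    "(\<Sum>i\<in>A. r *\<^sub>R (star k * (star (x i) * y i))) = r *\<^sub>R (star k * k)"
    "(\<Sum>i\<in>A. r *\<^sub>R (star (y i) * x i * k)) = r *\<^sub>R (star k * k)"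
    unfolding scaleR_sum_right[symmetric] sum_distrib_left[symmetric] sum_distrib_right[symmetric]
    by (simp_all only: g_def k_def[symmetric] sk[symmetric])
  define z where "z i = r *\<^sub>R (x i * k) - y i" for i
  have "star (z i) * z i = r\<^sup>2 *\<^sub>R (star k * (star (x i) * x i) * k) - r *\<^sub>R (star k * (star (x i) * y i))
      - r *\<^sub>R ((star (y i) * x i) * k) + star (y i) * y i" for i
    by (simp add: z_def star_diff star_scaleR star_mult algebra_simps power2_eq_square)
  then have "(\<Sum>i\<in>A. star (z i) * z i) =
      r\<^sup>2 *\<^sub>R (star k * g * k) - r *\<^sub>R (star k * k) - r *\<^sub>R (star k * k) + h"
    by (simp add: sum.distrib sum_subtractf sums flip: h_def)
  moreover have "r\<^sup>2 *\<^sub>R (star k * (of_real c - g) * k) = r *\<^sub>R (star k * k) - r\<^sup>2 *\<^sub>R (star k * g * k)"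
    using r(2) by (simp add: algebra_simps of_real_def power2_eq_square)
  ultimately have eq: "h - r *\<^sub>R (star k * k) =
      (\<Sum>i\<in>A. star (z i) * z i) + r\<^sup>2 *\<^sub>R (star k * (of_real c - g) * k)"
    by simp
  have "cstar_pos (of_real c - g)"
    using c(1) by (intro cstar_pos_of_real_diff[OF sg]) (simp add: g_def)
  then have "cstar_pos (h - r *\<^sub>R (star k * k))"
    unfolding eq by (intro cstar_pos_add cstar_pos_sum cstar_pos_star_mult cstar_pos_scaleR
        cstar_pos_conj) auto
  then have "norm (r *\<^sub>R (star k * k)) \<le> norm h"
    using r(1) by (intro norm_mono_pos cstar_pos_scaleR cstar_pos_star_mult) auto
  then have "c * (r * (norm k)\<^sup>2) \<le> c * norm h"
    using r(1) c(2) by (simp add: cstar_identity)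
  then show ?thesis
    using r(2) unfolding k_def h_def by (simp add: mult.commute mult.left_commute flip: mult.assoc)
qed

lemma column_norm_nonneg [simp]: "0 \<le> column_norm n x"
  by (simp add: column_norm_def)

lemma column_norm_power2: "(column_norm n x)\<^sup>2 = norm (\<Sum>i<n. star (x i) * x i)"
  by (simp add: column_norm_def)

lemma column_norm_cong: "(\<And>i. i < n \<Longrightarrow> x i = y i) \<Longrightarrow> column_norm n x = column_norm n y"
  by (simp add: column_norm_def)

lemma column_norm_zero [simp]: "column_norm n (\<lambda>_. 0) = 0"
  by (simp add: column_norm_def)

lemma column_norm_mono:
  assumes "n \<le> m" "\<And>i. i < n \<Longrightarrow> x i = y i \<or> x i = 0"
  shows "column_norm n x \<le> column_norm m y"
proof -
  have "(\<Sum>i<n. star (x i) * x i) = (\<Sum>i\<in>{i. i < n \<and> x i = y i}. star (y i) * y i)"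
    by (intro sum.mono_neutral_cong_right) (auto, metis assms(2) mult_zero_right)
  then have "norm (\<Sum>i<n. star (x i) * x i) \<le> norm (\<Sum>i<m. star (y i) * y i)"
    using assms(1) by (auto intro: norm_sum_star_mult_mono)
  then show ?thesis
    by (simp add: column_norm_def)
qed

lemma norm_le_column_norm:
  assumes "i < n"
  shows "norm (x i) \<le> column_norm n x"
proof -
  have "norm (\<Sum>i\<in>{i}. star (x i) * x i) \<le> norm (\<Sum>i<n. star (x i) * x i)"
    using assms by (intro norm_sum_star_mult_mono) auto
  then have "(norm (x i))\<^sup>2 \<le> (column_norm n x)\<^sup>2"
    by (simp add: cstar_identity column_norm_power2)
  then show ?thesis
    by (rule power2_le_imp_le) simp
qed

lemma column_norm_pad:
  assumes "n \<le> m"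
  shows "column_norm m (\<lambda>i. if i < n then x i else 0) = column_norm n x"
proof -
  have "(\<Sum>i<m. star (if i < n then x i else 0) * (if i < n then x i else 0)) =
      (\<Sum>i<n. star (x i) * x i)"
    using assms by (intro sum.mono_neutral_cong_right) auto
  then show ?thesis
    by (simp add: column_norm_def)
qed

lemma column_norm_scaleR: "column_norm n (\<lambda>i. r *\<^sub>R x i) = \<bar>r\<bar> * column_norm n x"
proof -
  have "(\<Sum>i<n. star (r *\<^sub>R x i) * (r *\<^sub>R x i)) = r\<^sup>2 *\<^sub>R (\<Sum>i<n. star (x i) * x i)"
    by (simp add: star_scaleR scaleR_sum_right power2_eq_square)
  then show ?thesis
    by (simp add: column_norm_def real_sqrt_mult)
qed

lemma column_Cauchy_Schwarz:
  "norm (\<Sum>i<n. star (x i) * y i) \<le> column_norm n x * column_norm n y"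
proof (cases "column_norm n x = 0")
  case True
  then have "x i = 0" if "i < n" for i
    using norm_le_column_norm[OF that, of x] by simp
  then show ?thesis
    by simp
next
  case False
  define c where "c = norm (\<Sum>i<n. star (x i) * x i)"
  have "c > 0"
    using False by (simp add: c_def column_norm_def)
  moreover have emb: "(\<Sum>i<n. star (emb (u i)) * emb (v i)) = emb (\<Sum>i<n. star (u i) * v i)"
    for u v :: "nat \<Rightarrow> 'a"
    by (simp add: emb_sum emb_simps emb_star)
  ultimately have "(norm (\<Sum>i<n. star (x i) * y i))\<^sup>2 \<le> c * norm (\<Sum>i<n. star (y i) * y i)"
    using Cauchy_Schwarz_unital[of "\<lambda>i. emb (x i)" "{..<n}" c "\<lambda>i. emb (y i)"]
    by (simp add: c_def)
  also have "\<dots> = (column_norm n x * column_norm n y)\<^sup>2"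
    by (simp add: power_mult_distrib column_norm_power2 c_def)
  finally show ?thesis
    by (rule power2_le_imp_le) simp
qed

lemma column_norm_triangle:
  "column_norm n (\<lambda>i. x i + y i) \<le> column_norm n x + column_norm n y"
proof -
  let ?p = "\<lambda>x y. \<Sum>i<n. star (x i) * y i"
  have "(column_norm n (\<lambda>i. x i + y i))\<^sup>2 = norm (?p x x + ?p x y + (?p y x + ?p y y))"
    by (simp add: column_norm_power2 star_add algebra_simps sum.distrib)
  also have "\<dots> \<le> norm (?p x x) + norm (?p x y) + (norm (?p y x) + norm (?p y y))"
    by (intro norm_triangle_le add_mono order_refl norm_triangle_ineq)
  also have "\<dots> \<le> (column_norm n x)\<^sup>2 + column_norm n x * column_norm n y +
      (column_norm n y * column_norm n x + (column_norm n y)\<^sup>2)"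
    by (intro add_mono column_Cauchy_Schwarz) (simp_all add: column_norm_power2)
  also have "\<dots> = (column_norm n x + column_norm n y)\<^sup>2"
    by (simp add: power2_eq_square algebra_simps)
  finally show ?thesis
    by (rule power2_le_imp_le) simp
qed

section \<open>Bounded infinite matrices\<close>

text \<open>One constant for all corners, stated through the sesquilinear form: this is symmetric
  under adjoints and survives entrywise limits.\<close>

definition mat_bound :: "real \<Rightarrow> 'a::cstar_algebra inf_matrix \<Rightarrow> bool" where
  "mat_bound C S \<longleftrightarrow> 0 \<le> C \<and> (\<forall>n x y. norm (\<Sum>i<n. \<Sum>j<n. star (y i) * S i j * x j)
     \<le> C * column_norm n y * column_norm n x)"

text \<open>The form is tested against \<open>y = S x\<close>; padding \<open>x\<close> with zeros
  reconciles the lengths \<open>m\<close> and \<open>n\<close>.\<close>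

lemma mat_bound_column:
  assumes S: "mat_bound C S"
  shows "column_norm m (\<lambda>i. \<Sum>j<n. S i j * x j) \<le> C * column_norm n x"
proof -
  define N where "N = max m n"
  define z where "z i = (if i < n then x i else 0)" for i
  define y where "y i = (\<Sum>j<N. S i j * z j)" for i
  have eq: "y i = (\<Sum>j<n. S i j * x j)" for i
    unfolding y_def z_def by (intro sum.mono_neutral_cong_right) (auto simp: N_def)
  have "star (y i) * y i = (\<Sum>j<N. star (y i) * S i j * z j)" for i
    by (subst (2) y_def) (simp add: sum_distrib_left mult.assoc)
  then have "(column_norm N y)\<^sup>2 = norm (\<Sum>i<N. \<Sum>j<N. star (y i) * S i j * z j)"
    by (simp add: column_norm_power2)
  also have "\<dots> \<le> C * column_norm N y * column_norm N z"
    using S by (simp add: mat_bound_def)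
  finally have "column_norm N y * column_norm N y \<le> column_norm N y * (C * column_norm N z)"
    by (simp add: power2_eq_square mult_ac)
  moreover have "0 \<le> C"
    using S by (simp add: mat_bound_def)
  ultimately have "column_norm N y \<le> C * column_norm N z"
    by (cases "column_norm N y = 0") (auto simp: less_le)
  moreover have "column_norm N z = column_norm n x"
    unfolding z_def by (rule column_norm_pad) (simp add: N_def)
  moreover have "column_norm m y \<le> column_norm N y"
    by (rule column_norm_mono) (auto simp: N_def)
  ultimately show ?thesis
    by (simp flip: eq)
qed

lemma mat_boundI:
  assumes C: "0 \<le> C"
    and le: "\<And>n x. N \<le> n \<Longrightarrow> column_norm n (\<lambda>i. \<Sum>j<n. S i j * x j) \<le> C * column_norm n x"
  shows "mat_bound C S"
  unfolding mat_bound_def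
proof (intro conjI allI C)
  fix n and x y :: "nat \<Rightarrow> 'a"
  define m where "m = max n N"
  define z where "z i = (if i < n then x i else 0)" for i
  have eq: "(\<Sum>j<m. S i j * z j) = (\<Sum>j<n. S i j * x j)" for i
    unfolding z_def by (intro sum.mono_neutral_cong_right) (auto simp: m_def)
  have "column_norm n (\<lambda>i. \<Sum>j<n. S i j * x j) \<le> column_norm m (\<lambda>i. \<Sum>j<m. S i j * z j)"
    by (rule column_norm_mono) (simp add: m_def, simp add: eq)
  also have "\<dots> \<le> C * column_norm m z"
    by (rule le) (simp add: m_def)
  also have "column_norm m z = column_norm n x"
    unfolding z_def by (rule column_norm_pad) (simp add: m_def)
  finally have "column_norm n y * column_norm n (\<lambda>i. \<Sum>j<n. S i j * x j)
      \<le> column_norm n y * (C * column_norm n x)"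
    by (rule mult_left_mono) simp
  moreover have "(\<Sum>i<n. \<Sum>j<n. star (y i) * S i j * x j) =
      (\<Sum>i<n. star (y i) * (\<Sum>j<n. S i j * x j))"
    by (simp add: sum_distrib_left mult.assoc)
  ultimately show "norm (\<Sum>i<n. \<Sum>j<n. star (y i) * S i j * x j)
      \<le> C * column_norm n y * column_norm n x"
    using column_Cauchy_Schwarz[of y "\<lambda>i. \<Sum>j<n. S i j * x j" n] by (simp add: mult_ac)
qed

lemma mat_bound_star:
  assumes "mat_bound C S"
  shows "mat_bound C (stab_star S)"
  unfolding mat_bound_def
proof (intro conjI allI)
  fix n and x y :: "nat \<Rightarrow> 'a"
  have "star (\<Sum>i<n. \<Sum>j<n. star (x i) * S i j * y j) =
      (\<Sum>j<n. \<Sum>i<n. star (y i) * stab_star S i j * x j)"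
    by (simp add: star_sum star_mult star_star stab_star_def mult.assoc)
  also have "\<dots> = (\<Sum>i<n. \<Sum>j<n. star (y i) * stab_star S i j * x j)"
    by (rule sum.swap)
  finally have "norm (star (\<Sum>i<n. \<Sum>j<n. star (x i) * S i j * y j)) =
      norm (\<Sum>i<n. \<Sum>j<n. star (y i) * stab_star S i j * x j)"
    by (rule arg_cong)
  then have "norm (\<Sum>i<n. \<Sum>j<n. star (y i) * stab_star S i j * x j) =
      norm (\<Sum>i<n. \<Sum>j<n. star (x i) * S i j * y j)"
    by (simp only: norm_star)
  also have "\<dots> \<le> C * column_norm n x * column_norm n y"
    using assms by (simp add: mat_bound_def)
  finally show "norm (\<Sum>i<n. \<Sum>j<n. star (y i) * stab_star S i j * x j)
      \<le> C * column_norm n y * column_norm n x"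
    by (simp add: mult_ac)
qed (use assms in \<open>simp add: mat_bound_def\<close>)

lemma mat_bound_diff:
  assumes "mat_bound C S" "mat_bound D T"
  shows "mat_bound (C + D) (stab_diff S T)"
  unfolding mat_bound_def
proof (intro conjI allI)
  fix n and x y :: "nat \<Rightarrow> 'a"
  let ?b = "\<lambda>S :: 'a inf_matrix. \<Sum>i<n. \<Sum>j<n. star (y i) * S i j * x j"
  have "norm (?b (stab_diff S T)) \<le> norm (?b S) + norm (?b T)"
    using norm_triangle_ineq4[of "?b S" "?b T"]
    by (simp add: stab_diff_def algebra_simps sum_subtractf)
  also have "\<dots> \<le> C * column_norm n y * column_norm n x + D * column_norm n y * column_norm n x"
    using assms by (intro add_mono) (simp_all add: mat_bound_def)
  finally show "norm (?b (stab_diff S T)) \<le> (C + D) * column_norm n y * column_norm n x"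
    by (simp add: algebra_simps)
qed (use assms in \<open>simp add: mat_bound_def\<close>)

text \<open>Without a unit there is no basis vector to pick out column \<open>j\<close>. The test
  vector has \<open>g\<close>, the inner square of that column, in place \<open>j\<close>; this
  gives \<open>norm (g * g * g) \<le> K^2 * (norm g)^2\<close>, and the C*-identity for
  \<open>g * g\<close> reduces it to \<open>norm g \<le> K^2\<close>.\<close>

lemma column_le_of_bound:
  assumes K: "\<And>x. column_norm n (\<lambda>i. \<Sum>j<n. S i j * x j) \<le> K * column_norm n x"
    and "0 \<le> K" and j: "j < n"
  shows "column_norm n (\<lambda>i. S i j) \<le> K"
proof -
  define g where "g = (\<Sum>i<n. star (S i j) * S i j)"
  have sg: "star g = g"
    by (simp add: g_def star_sum star_mult star_star)
  have sel: "(\<Sum>l<n. F l * (if l = j then g else 0)) = F j * g" for F :: "nat \<Rightarrow> 'a"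
    using j by (simp add: if_distrib[of "\<lambda>x. F _ * x"] sum.delta cong: if_cong)
  have "column_norm n (\<lambda>l. if l = j then g else 0) = norm g"
  proof -
    have "(\<Sum>l<n. star (if l = j then g else 0) * (if l = j then g else 0)) = star g * g"
      using sel[of "\<lambda>l. star (if l = j then g else 0)"] by simp
    then show ?thesis
      by (simp add: column_norm_def cstar_identity)
  qed
  then have "column_norm n (\<lambda>i. S i j * g) \<le> K * norm g"
    using K[of "\<lambda>l. if l = j then g else 0"] by (simp add: sel)
  then have "(column_norm n (\<lambda>i. S i j * g))\<^sup>2 \<le> (K * norm g)\<^sup>2"
    by (intro power_mono) simp_all
  moreover have "(\<Sum>i<n. star (S i j * g) * (S i j * g)) = g * g * g"
  proof -
    have "(\<Sum>i<n. star (S i j * g) * (S i j * g)) = g * (\<Sum>i<n. star (S i j) * S i j) * g"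
      by (simp add: star_mult sg sum_distrib_left sum_distrib_right mult.assoc)
    then show ?thesis
      by (simp flip: g_def)
  qed
  ultimately have "norm (g * g * g) \<le> K\<^sup>2 * (norm g)\<^sup>2"
    by (simp add: column_norm_power2 power_mult_distrib)
  moreover have "(norm g)\<^sup>2 * (norm g)\<^sup>2 \<le> norm (g * g * g) * norm g"
  proof -
    have "norm (g * g) = (norm g)\<^sup>2"
      using cstar_identity[of g] by (simp add: sg)
    then have "(norm g)\<^sup>2 * (norm g)\<^sup>2 = norm (star (g * g) * (g * g))"
      by (simp only: cstar_identity power2_eq_square)
    then show ?thesis
      using norm_mult_ineq[of "g * g * g" g] by (simp add: star_mult sg mult.assoc)
  qed
  ultimately have "(norm g)\<^sup>2 * (norm g)\<^sup>2 \<le> K\<^sup>2 * (norm g)\<^sup>2 * norm g"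
    by (meson mult_right_mono norm_ge_zero order_trans)
  then have "norm g \<le> K\<^sup>2"
    by (cases "norm g = 0") (simp_all add: power2_eq_square)
  then show ?thesis
    using \<open>0 \<le> K\<close> unfolding column_norm_def g_def by (intro real_le_lsqrt) auto
qed


text \<open>The adjoint of the row is a test vector whose image has the inner square of the row as
  its \<open>i\<close>-th entry.\<close>

lemma row_le_of_bound:
  assumes K: "\<And>x. column_norm n (\<lambda>i. \<Sum>j<n. S i j * x j) \<le> K * column_norm n x"
    and "0 \<le> K" and i: "i < n"
  shows "column_norm n (\<lambda>j. star (S i j)) \<le> K"
proof -
  let ?c = "column_norm n (\<lambda>j. star (S i j))"
  define s where "s j = star (S i j)" for j
  have "?c\<^sup>2 = norm (\<Sum>j<n. S i j * s j)"
    by (simp add: column_norm_power2 star_star s_def)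
  also have "\<dots> \<le> column_norm n (\<lambda>l. \<Sum>j<n. S l j * s j)"
    by (rule norm_le_column_norm[OF i])
  also have "\<dots> \<le> K * column_norm n s"
    by (rule K)
  also have "column_norm n s = ?c"
    by (rule column_norm_cong) (simp add: s_def)
  finally have "?c * ?c \<le> K * ?c"
    by (simp add: power2_eq_square)
  then show ?thesis
    using \<open>0 \<le> K\<close> by (cases "?c = 0") (auto simp: less_le)
qed

section \<open>The suprema defining the corner norm and the stable norm\<close>

lemma column_norm_le_sum: "column_norm n x \<le> (\<Sum>i<n. norm (x i))"
proof -
  have "norm (\<Sum>i<n. star (x i) * x i) \<le> (\<Sum>i<n. (norm (x i))\<^sup>2)"
    by (rule order_trans[OF norm_sum]) (simp add: cstar_identity)
  then have "column_norm n x \<le> L2_set (\<lambda>i. norm (x i)) {..<n}"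
    by (simp add: column_norm_def L2_set_def)
  also have "\<dots> \<le> (\<Sum>i<n. norm (x i))"
    by (rule L2_set_le_sum) simp
  finally show ?thesis .
qed

lemma column_norm_mult_le_sum:
  "column_norm n (\<lambda>i. \<Sum>j<n. S i j * x j) \<le> (\<Sum>i<n. \<Sum>j<n. norm (S i j)) * column_norm n x"
proof -
  have "norm (\<Sum>j<n. S i j * x j) \<le> (\<Sum>j<n. norm (S i j) * column_norm n x)" for i
    by (intro order_trans[OF norm_sum] sum_mono order_trans[OF norm_mult_ineq] mult_left_mono
        norm_le_column_norm) auto
  then show ?thesis
    by (intro order_trans[OF column_norm_le_sum]) (simp add: sum_distrib_right sum_mono)
qed

lemma bdd_above_corner_norm:
  "bdd_above ((\<lambda>x. column_norm n (\<lambda>i. \<Sum>j<n. S i j * x j)) ` {x. column_norm n x \<le> 1})"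
proof (rule bdd_aboveI2)
  fix x :: "nat \<Rightarrow> 'a"
  assume "x \<in> {x. column_norm n x \<le> 1}"
  then show "column_norm n (\<lambda>i. \<Sum>j<n. S i j * x j) \<le> (\<Sum>i<n. \<Sum>j<n. norm (S i j)) * 1"
    by (intro order_trans[OF column_norm_mult_le_sum] mult_left_mono) (simp_all add: sum_nonneg)
qed

lemma corner_norm_nonneg: "0 \<le> corner_norm n S"
proof -
  have "column_norm n (\<lambda>i. \<Sum>j<n. S i j * (0::'a)) \<le> corner_norm n S"
    unfolding corner_norm_def
    using cSUP_upper[OF _ bdd_above_corner_norm[of n S], of "\<lambda>_. 0"] by simp
  then show ?thesis
    by simp
qed

lemma corner_norm_upper:
  "column_norm n (\<lambda>i. \<Sum>j<n. S i j * x j) \<le> corner_norm n S * column_norm n x"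
proof (cases "column_norm n x = 0")
  case True
  then show ?thesis
    using column_norm_mult_le_sum[of n S x] by simp
next
  case False
  define r where "r = 1 / column_norm n x"
  have r: "r > 0" "r * column_norm n x = 1"
    using False by (simp_all add: r_def less_le)
  then have "column_norm n (\<lambda>i. r *\<^sub>R x i) \<le> 1"
    by (simp add: column_norm_scaleR)
  then have "column_norm n (\<lambda>i. \<Sum>j<n. S i j * (r *\<^sub>R x j)) \<le> corner_norm n S"
    unfolding corner_norm_def
    by (intro cSUP_upper[OF _ bdd_above_corner_norm[of n S]]) simp
  moreover have "(\<lambda>i. \<Sum>j<n. S i j * (r *\<^sub>R x j)) = (\<lambda>i. r *\<^sub>R (\<Sum>j<n. S i j * x j))"
    by (simp add: scaleR_sum_right)
  ultimately have "r * column_norm n (\<lambda>i. \<Sum>j<n. S i j * x j) \<le> corner_norm n S"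
    using r(1) by (simp add: column_norm_scaleR)
  then have "column_norm n x * (r * column_norm n (\<lambda>i. \<Sum>j<n. S i j * x j))
      \<le> column_norm n x * corner_norm n S"
    by (rule mult_left_mono) simp
  then show ?thesis
    using r(2) by (simp add: mult.commute[of "column_norm n x"] flip: mult.assoc)
qed

lemma corner_norm_least:
  assumes "mat_bound C S"
  shows "corner_norm n S \<le> C"
  unfolding corner_norm_def
proof (rule cSUP_least)
  show "{x. column_norm n x \<le> 1} \<noteq> {}"
    using column_norm_zero[of n] by (metis (mono_tags) empty_iff mem_Collect_eq zero_le_one)
  fix x :: "nat \<Rightarrow> 'a"
  assume "x \<in> {x. column_norm n x \<le> 1}"
  then have "C * column_norm n x \<le> C * 1"
    using assms by (intro mult_left_mono) (auto simp: mat_bound_def)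
  then show "column_norm n (\<lambda>i. \<Sum>j<n. S i j * x j) \<le> C"
    using mat_bound_column[OF assms, where m = n and n = n and x = x] by simp
qed

text \<open>The bound \<open>C\<close> makes the corner norms bounded above, so that their supremum
  really dominates each of them.\<close>

lemma norm_entry_le_stab_norm:
  assumes "mat_bound C T"
  shows "norm (T i j) \<le> stab_norm T"
proof -
  define n where "n = Suc (max i j)"
  have n: "i < n" "j < n"
    by (auto simp: n_def)
  have "norm (T i j) \<le> column_norm n (\<lambda>i. T i j)"
    by (rule norm_le_column_norm[OF n(1)])
  also have "\<dots> \<le> corner_norm n T"
    by (rule column_le_of_bound[OF corner_norm_upper corner_norm_nonneg n(2)])
  also have "\<dots> \<le> stab_norm T"
    unfolding stab_norm_def
    by (rule cSUP_upper) (auto intro: bdd_aboveI2 corner_norm_least[OF assms])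
  finally show ?thesis .
qed

section \<open>Convergence and boundedness of matrix products\<close>

lemma mat_bound_columns:
  assumes "mat_bound C S"
  shows "column_norm n (\<lambda>i. S i j) \<le> C"
proof -
  have "column_norm n (\<lambda>i. S i j) \<le> column_norm (max n (Suc j)) (\<lambda>i. S i j)"
    by (rule column_norm_mono) auto
  also have "\<dots> \<le> C"
    using assms by (rule column_le_of_bound[OF mat_bound_column]) (use assms in \<open>auto simp: mat_bound_def\<close>)
  finally show ?thesis .
qed

text \<open>Membership in the infinite standard Hilbert module. Such a vector can be paired with one
  whose partial norms are merely bounded.\<close>

definition tail_null :: "(nat \<Rightarrow> 'a::cstar_algebra) \<Rightarrow> bool" where
  "tail_null v \<longleftrightarrow> (\<forall>e>0. \<exists>N. \<forall>n. column_norm n (\<lambda>k. if k < N then 0 else v k) \<le> e)"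

lemma summable_tail_null:
  assumes v: "tail_null v" and w: "\<And>n. column_norm n w \<le> C"
  shows "summable (\<lambda>k. star (v k) * w k)"
  unfolding summable_Cauchy
proof (intro allI impI)
  fix e :: real
  assume "e > 0"
  have C: "0 \<le> C"
    using w[of 0] column_norm_nonneg order_trans by blast
  \<comment> \<open>The summand 1 covers \<open>C = 0\<close> and makes the final inequality
    strict.\<close>
  define d where "d = e / (C + 1)"
  have "d > 0"
    using \<open>e > 0\<close> C by (simp add: d_def)
  then obtain N where N: "\<And>n. column_norm n (\<lambda>k. if k < N then 0 else v k) \<le> d"
    using v by (auto simp: tail_null_def)
  have "norm (\<Sum>k=m..<n. star (v k) * w k) < e" if "m \<ge> N" for m n
  proof -
    have "(\<Sum>k=m..<n. star (v k) * w k) = (\<Sum>k<n. star (if k < m then 0 else v k) * w k)"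
      by (intro sum.mono_neutral_cong_left) auto
    then have "norm (\<Sum>k=m..<n. star (v k) * w k)
        \<le> column_norm n (\<lambda>k. if k < m then 0 else v k) * column_norm n w"
      by (simp add: column_Cauchy_Schwarz)
    also have "\<dots> \<le> d * C"
    proof (rule mult_mono)
      have "column_norm n (\<lambda>k. if k < m then 0 else v k)
          \<le> column_norm n (\<lambda>k. if k < N then 0 else v k)"
        using that by (intro column_norm_mono) auto
      then show "column_norm n (\<lambda>k. if k < m then 0 else v k) \<le> d"
        using N order_trans by blast
    qed (use w C \<open>d > 0\<close> in auto)
    also have "\<dots> < d * (C + 1)"
      using \<open>d > 0\<close> by simp
    also have "\<dots> = e"
      using C by (simp add: d_def)
    finally show ?thesis .
  qed
  then show "\<exists>N. \<forall>m\<ge>N. \<forall>n. norm (\<Sum>k=m..<n. star (v k) * w k) < e"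
    by blast
qed

lemma summable_tail_null':
  assumes v: "tail_null v" and w: "\<And>n. column_norm n w \<le> C"
  shows "summable (\<lambda>k. star (w k) * v k)"
  using bounded_linear.summable[OF bounded_linear_star summable_tail_null[OF assms]]
  by (simp add: star_mult star_star)

text \<open>Once \<open>N\<close> exceeds \<open>j\<close>, the part of column or row
  \<open>j\<close> from index \<open>N\<close> on is a column or row of a difference of two
  truncations, and that difference is small by the Cauchy condition.\<close>

lemma stabilization_tails:
  assumes S: "S \<in> stabilization"
  shows "tail_null (\<lambda>k. S k j)" "tail_null (\<lambda>k. star (S j k))"
proof -
  have *: "\<exists>N. \<forall>n. column_norm n (\<lambda>k. if k < N then 0 else S k j) \<le> e \<and>
      column_norm n (\<lambda>k. if k < N then 0 else star (S j k)) \<le> e" if "e > 0" for e :: real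
  proof -
    obtain N' where N': "\<And>m n. m \<ge> N' \<Longrightarrow> n \<ge> N' \<Longrightarrow>
        corner_norm (max m n) (\<lambda>i j. truncate m S i j - truncate n S i j) < e"
      using S \<open>e > 0\<close> unfolding stabilization_def by blast
    define N where "N = max N' (Suc j)"
    have "column_norm n (\<lambda>k. if k < N then 0 else S k j) \<le> e \<and>
        column_norm n (\<lambda>k. if k < N then 0 else star (S j k)) \<le> e" for n
    proof (cases "N \<le> n")
      case True
      define D where "D = (\<lambda>i j. truncate n S i j - truncate N S i j)"
      have "corner_norm n D < e"
        using N'[of n N] True by (simp add: D_def N_def max_def split: if_splits)
      moreover have "j < n"
        using True by (simp add: N_def)
      moreover have "column_norm n (\<lambda>k. if k < N then 0 else S k j) = column_norm n (\<lambda>k. D k j)"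
        "column_norm n (\<lambda>k. if k < N then 0 else star (S j k)) = column_norm n (\<lambda>k. star (D j k))"
        using True by (auto simp: D_def truncate_def N_def intro!: column_norm_cong)
      ultimately show ?thesis
        using column_le_of_bound[OF corner_norm_upper corner_norm_nonneg, of j n D]
          row_le_of_bound[OF corner_norm_upper corner_norm_nonneg, of j n D] by simp
    next
      case False
      then have "column_norm n (\<lambda>k. if k < N then 0 else v k) = 0" for v :: "nat \<Rightarrow> 'a"
        using column_norm_cong[of n "\<lambda>k. if k < N then 0 else v k" "\<lambda>_. 0"] by simp
      then show ?thesis
        using \<open>e > 0\<close> by simp
    qed
    then show ?thesis
      by blast
  qed
  show "tail_null (\<lambda>k. S k j)" "tail_null (\<lambda>k. star (S j k))"
    unfolding tail_null_def using * by blast+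
qed

text \<open>A fixed corner is bounded crudely by the sum \<open>K\<close> of the norms of its
  entries; every larger corner differs from it by norm less than 1.\<close>

lemma stabilization_mat_bound:
  assumes S: "S \<in> stabilization"
  obtains C where "mat_bound C S"
proof -
  obtain N where N: "\<And>m n. m \<ge> N \<Longrightarrow> n \<ge> N \<Longrightarrow>
      corner_norm (max m n) (\<lambda>i j. truncate m S i j - truncate n S i j) < 1"
    using S zero_less_one unfolding stabilization_def by blast
  define K where "K = (\<Sum>i<N. \<Sum>j<N. norm (S i j))"
  have "mat_bound (1 + K) S"
  proof (rule mat_boundI[of _ N])
    show "0 \<le> 1 + K"
      by (simp add: K_def sum_nonneg add_nonneg_nonneg)
    fix n and x :: "nat \<Rightarrow> 'a"
    assume n: "N \<le> n"
    define D where "D = (\<lambda>i j. truncate n S i j - truncate N S i j)"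
    have "column_norm n (\<lambda>i. \<Sum>j<n. S i j * x j) =
        column_norm n (\<lambda>i. (\<Sum>j<n. D i j * x j) + (\<Sum>j<n. truncate N S i j * x j))"
      by (rule column_norm_cong)
        (simp add: D_def truncate_def algebra_simps sum_subtractf flip: sum.distrib)
    also have "\<dots> \<le> column_norm n (\<lambda>i. \<Sum>j<n. D i j * x j) +
        column_norm n (\<lambda>i. \<Sum>j<n. truncate N S i j * x j)"
      by (rule column_norm_triangle)
    also have "\<dots> \<le> 1 * column_norm n x + K * column_norm n x"
    proof (rule add_mono)
      have "corner_norm n D < 1"
        using N[of n N] n by (simp add: D_def max_def split: if_splits)
      then show "column_norm n (\<lambda>i. \<Sum>j<n. D i j * x j) \<le> 1 * column_norm n x"
        by (intro order_trans[OF corner_norm_upper] mult_right_mono) auto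
      have "(\<Sum>i<n. \<Sum>j<n. norm (truncate N S i j)) = K"
        unfolding K_def using n
        by (intro sum.mono_neutral_cong_right ballI sum.neutral) (auto simp: truncate_def)
      then show "column_norm n (\<lambda>i. \<Sum>j<n. truncate N S i j * x j) \<le> K * column_norm n x"
        using column_norm_mult_le_sum[of n "truncate N S" x] by simp
    qed
    finally show "column_norm n (\<lambda>i. \<Sum>j<n. S i j * x j) \<le> (1 + K) * column_norm n x"
      by (simp add: algebra_simps)
  qed
  then show ?thesis
    by (rule that)
qed

text \<open>Cutting the inner index at \<open>N\<close> gives the pairing of
  \<open>stab_star S\<close> applied to \<open>y\<close> with \<open>T\<close> applied to
  \<open>x\<close>, to which Cauchy-Schwarz applies uniformly in \<open>N\<close>.\<close>

lemma mat_bound_mult: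
  assumes S: "mat_bound C S" and T: "mat_bound D T"
    and sum: "\<And>i l. summable (\<lambda>k. S i k * T k l)"
  shows "mat_bound (C * D) (stab_mult S T)"
  unfolding mat_bound_def
proof (intro conjI allI)
  fix n and x y :: "nat \<Rightarrow> 'a"
  define B where "B N = (\<Sum>i<n. \<Sum>l<n. star (y i) * (\<Sum>k<N. S i k * T k l) * x l)" for N
  have "(\<lambda>N. \<Sum>k<N. S i k * T k l) \<longlonglongrightarrow> stab_mult S T i l" for i l
    using summable_LIMSEQ[OF sum] by (simp add: stab_mult_def)
  then have lim: "B \<longlonglongrightarrow> (\<Sum>i<n. \<Sum>l<n. star (y i) * stab_mult S T i l * x l)"
    unfolding B_def by (intro tendsto_intros)
  have "norm (B N) \<le> (C * D) * column_norm n y * column_norm n x" for N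
  proof -
    define v where "v k = (\<Sum>i<n. stab_star S k i * y i)" for k
    define w where "w k = (\<Sum>l<n. T k l * x l)" for k
    have "B N = (\<Sum>i<n. \<Sum>l<n. \<Sum>k<N. star (y i) * S i k * (T k l * x l))"
      by (simp add: B_def sum_distrib_left sum_distrib_right mult.assoc)
    also have "\<dots> = (\<Sum>i<n. \<Sum>k<N. star (y i) * S i k * w k)"
      by (subst sum.swap) (simp add: w_def sum_distrib_left)
    also have "\<dots> = (\<Sum>k<N. star (v k) * w k)"
      by (subst sum.swap)
        (simp add: v_def star_sum star_mult stab_star_def star_star sum_distrib_right)
    finally have "norm (B N) \<le> column_norm N v * column_norm N w"
      by (simp add: column_Cauchy_Schwarz)
    also have "\<dots> \<le> (C * column_norm n y) * (D * column_norm n x)"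
      using S unfolding v_def w_def
      by (intro mult_mono mat_bound_column mat_bound_star S T) (auto simp: mat_bound_def)
    finally show ?thesis
      by (simp add: mult_ac)
  qed
  then show "norm (\<Sum>i<n. \<Sum>l<n. star (y i) * stab_mult S T i l * x l)
      \<le> C * D * column_norm n y * column_norm n x"
    by (intro LIMSEQ_le_const2[OF tendsto_norm[OF lim]]) auto
qed (use S T in \<open>simp add: mat_bound_def\<close>)

lemma summable_star_mult_columns:
  assumes "X \<in> stabilization"
  shows "summable (\<lambda>k. star (X k i) * X k j)"
proof -
  obtain C where "mat_bound C X"
    using stabilization_mat_bound[OF assms] .
  then show ?thesis
    by (intro summable_tail_null stabilization_tails assms mat_bound_columns)
qed

lemma stab_positives_mat_bound:
  assumes "P \<in> stab_positives"
  obtains C where "mat_bound C P"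
proof -
  obtain X where X: "X \<in> stabilization" "P = stab_mult (stab_star X) X"
    using assms by (auto simp: stab_positives_def)
  obtain C where "mat_bound C X"
    using stabilization_mat_bound[OF X(1)] .
  then have "mat_bound (C * C) P"
    unfolding X(2) using summable_star_mult_columns[OF X(1)]
    by (intro mat_bound_mult mat_bound_star) (simp_all add: stab_star_def)
  then show ?thesis
    by (rule that)
qed

section \<open>Cuntz comparison and ideals\<close>

context
  fixes I :: "'a::cstar_algebra set"
  assumes I: "closed_ideal I"
begin

text \<open>The entries of \<open>r Q (star r)\<close> are convergent series in the ideal, as rows
  of \<open>r\<close> have null tails and the other factor is bounded. Convergence in
  \<open>stab_norm\<close> forces entrywise convergence, and the ideal is closed.\<close>

lemma cuntz_below_ideal:
  assumes P: "P \<in> stab_positives" and Q: "Q \<in> stab_positives" "\<And>i j. Q i j \<in> I"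
    and below: "cuntz_below P Q"
  shows "P i j \<in> I"
proof -
  obtain r where r: "\<And>n. r n \<in> stabilization"
    and lim: "(\<lambda>n. stab_norm (stab_diff P (stab_mult (stab_mult (r n) Q) (stab_star (r n)))))
      \<longlonglongrightarrow> 0"
    using below by (auto simp: cuntz_below_def)
  define T where "T n = stab_mult (stab_mult (r n) Q) (stab_star (r n))" for n
  obtain C where C: "mat_bound C P"
    using stab_positives_mat_bound[OF P] .
  obtain D where D: "mat_bound D Q"
    using stab_positives_mat_bound[OF Q(1)] .
  have T: "T n i j \<in> I \<and> norm (P i j - T n i j) \<le> stab_norm (stab_diff P (T n))" for n
  proof -
    obtain B where B: "mat_bound B (r n)"
      using stabilization_mat_bound[OF r] .
    have sum: "summable (\<lambda>k. r n i k * Q k l)" for i l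
      using summable_tail_null[OF stabilization_tails(2)[OF r, of n i] mat_bound_columns[OF D]]
      by (simp add: star_star)
    define R where "R = stab_mult (r n) Q"
    have RI: "R i k \<in> I" for i k
      unfolding R_def stab_mult_def
      by (rule ideal_suminf[OF I sum]) (rule ideal_mult_left[OF I Q(2)])
    have R: "mat_bound (B * D) R"
      unfolding R_def by (rule mat_bound_mult[OF B D sum])
    have sum': "summable (\<lambda>k. R i k * stab_star (r n) k j)" for i j
      using summable_tail_null'[OF stabilization_tails(2)[OF r, of n j]
          mat_bound_columns[OF mat_bound_star[OF R]], of i]
      by (simp add: stab_star_def star_star)
    have "T n i j \<in> I"
      unfolding T_def R_def[symmetric] stab_mult_def[of R]
      by (rule ideal_suminf[OF I sum']) (rule ideal_mult_right[OF I RI])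
    moreover have "mat_bound (B * D * B) (T n)"
      unfolding T_def R_def[symmetric] by (rule mat_bound_mult[OF R mat_bound_star[OF B] sum'])
    then have "norm (stab_diff P (T n) i j) \<le> stab_norm (stab_diff P (T n))"
      by (rule norm_entry_le_stab_norm[OF mat_bound_diff[OF C]])
    ultimately show ?thesis
      by (simp add: stab_diff_def)
  qed
  have "(\<lambda>n. P i j - T n i j) \<longlonglongrightarrow> 0"
    by (rule Lim_null_comparison[OF _ lim[folded T_def]]) (simp add: T)
  then have "(\<lambda>n. P i j - (P i j - T n i j)) \<longlonglongrightarrow> P i j - 0"
    by (intro tendsto_intros)
  then have "(\<lambda>n. T n i j) \<longlonglongrightarrow> P i j"
    by simp
  then show ?thesis
    by (rule closed_sequentially[OF ideal_closed[OF I], rotated]) (simp add: T)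
qed

text \<open>For \<open>P = star X X\<close>, the diagonal entry \<open>P j j\<close> dominates each
  \<open>star (X k j) * X k j\<close>. Heredity puts all entries of \<open>X\<close> into the ideal,
  hence also the off-diagonal entries of \<open>P\<close>.\<close>

lemma stab_positives_summand_ideal:
  assumes P: "P \<in> stab_positives" and Q: "Q \<in> stab_positives"
    and sum: "\<And>i. P i i + Q i i \<in> I"
  shows "P i j \<in> I"
proof -
  obtain X where X: "X \<in> stabilization" "P = stab_mult (stab_star X) X"
    using P by (auto simp: stab_positives_def)
  obtain Y where Y: "Y \<in> stabilization" "Q = stab_mult (stab_star Y) Y"
    using Q by (auto simp: stab_positives_def)
  have partial: "cstar_pos (emb (\<Sum>k. star (Z k j) * Z k j) - emb (\<Sum>k\<in>A. star (Z k j) * Z k j))"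
    if Z: "Z \<in> stabilization" and A: "A = {} \<or> A = {m}" for Z :: "'a inf_matrix" and j A m
  proof -
    let ?s = "\<lambda>A. \<Sum>k\<in>A. star (Z k j) * Z k j"
    \<comment> \<open>The shift by \<open>Suc m\<close> makes every partial sum contain the index
      \<open>m\<close>.\<close>
    have "(\<lambda>n. ?s {..<n + Suc m}) \<longlonglongrightarrow> (\<Sum>k. star (Z k j) * Z k j)"
      by (rule LIMSEQ_ignore_initial_segment)
        (rule summable_LIMSEQ[OF summable_star_mult_columns[OF Z]])
    then have "(\<lambda>n. emb (?s {..<n + Suc m}) - emb (?s A))
        \<longlonglongrightarrow> emb (\<Sum>k. star (Z k j) * Z k j) - emb (?s A)"
      by (intro tendsto_diff tendsto_const bounded_linear.tendsto[OF bounded_linear_emb])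
    moreover have "cstar_pos (emb (?s {..<n + Suc m}) - emb (?s A))" for n
    proof -
      have "?s {..<n + Suc m} - ?s A = ?s ({..<n + Suc m} - A)"
        using A by (intro sum_diff[symmetric]) auto
      then have "emb (?s {..<n + Suc m}) - emb (?s A) = emb (?s ({..<n + Suc m} - A))"
        by (simp only: emb_simps(2)[symmetric])
      then show ?thesis
        by (simp only: emb_sum emb_simps emb_star cstar_pos_sum cstar_pos_star_mult)
    qed
    ultimately show ?thesis
      by (rule cstar_pos_limit)
  qed
  have "X k j \<in> I" for k j
  proof (rule ideal_hereditary[OF I sum[of j]])
    have "cstar_pos ((emb (P j j) - emb (star (X k j) * X k j)) + emb (Q j j))"
      using partial[OF X(1), of "{k}" k j] partial[OF Y(1), of "{}" k j]
      by (intro cstar_pos_add) (simp_all add: X(2) Y(2) stab_mult_def stab_star_def emb_simps)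
    then show "cstar_pos (emb (P j j + Q j j) - star (emb (X k j)) * emb (X k j))"
      by (simp add: emb_simps emb_star algebra_simps)
  qed
  then have "star (X k i) * X k j \<in> I" for k
    by (rule ideal_mult_left[OF I])
  then show ?thesis
    unfolding X(2) stab_mult_def stab_star_def
    by (intro ideal_suminf[OF I] summable_star_mult_columns[OF X(1)])
qed

end

section \<open>Elements with a local unit\<close>

text \<open>The function is 0 up to 1/2, which leaves room for a local unit, and fixes 1, so that
  \<open>plateau c\<close> is still a unit wherever \<open>c\<close> is one.\<close>

definition plateau :: "'a::cstar_algebra \<Rightarrow> 'a" where
  "plateau c = alg (cfc (emb c) (\<lambda>t. max 0 (min 1 (2 * t - 1))))"

lemma emb_plateau:
  "c \<in> positives \<Longrightarrow> emb (plateau c) = cfc (emb c) (\<lambda>t. max 0 (min 1 (2 * t - 1)))"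
  unfolding plateau_def
  by (intro emb_alg scal_cfc_emb positives_star continuous_intros) auto

lemma plateau_local_unit:
  assumes c: "c \<in> positives"
  shows "plateau c \<in> positives_with_local_unit"
proof -
  let ?f = "\<lambda>t::real. max 0 (min 1 (2 * t - 1))" and ?g = "\<lambda>t::real. max 0 (min 1 (2 * t))"
  have cf: "continuous_on UNIV ?f" and cg: "continuous_on UNIV ?g"
    by (intro continuous_intros)+
  have sa: "star c = c" "star (emb c) = emb c"
    using positives_star[OF c] by (simp_all flip: emb_star)
  have "(\<lambda>t. ?f t * ?g t) = ?f"
    by (auto simp: fun_eq_iff max_def min_def)
  then have "cfc (emb c) ?f * cfc (emb c) ?g = cfc (emb c) ?f"
    using cfc_mult[OF sa(2) cf cg] by simp
  moreover have "emb (alg (cfc (emb c) ?g)) = cfc (emb c) ?g"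
    by (intro emb_alg scal_cfc_emb[OF sa(1) cg]) simp
  ultimately have "emb (plateau c) = emb (plateau c * alg (cfc (emb c) ?g))"
    by (simp add: emb_plateau[OF c] emb_simps)
  then have "plateau c = plateau c * alg (cfc (emb c) ?g)"
    by (simp only: emb_eq_iff)
  moreover have "alg (cfc (emb c) ?g) \<in> positives"
    by (rule cfc_emb_positive[OF c cg]) auto
  moreover have "plateau c \<in> positives"
    unfolding plateau_def by (rule cfc_emb_positive[OF c cf]) auto
  ultimately show ?thesis
    unfolding positives_with_local_unit_def by blast
qed

lemma plateau_in_closed_subspace:
  assumes c: "c \<in> positives"
    and V: "closed V" "0 \<in> V" "\<And>v w. v \<in> V \<Longrightarrow> w \<in> V \<Longrightarrow> v + w \<in> V"
      "\<And>v r. v \<in> V \<Longrightarrow> r *\<^sub>R v \<in> V" "\<And>v. v \<in> V \<Longrightarrow> v * emb c \<in> V" "emb c - 1 \<in> V"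
  shows "emb (plateau c) - 1 \<in> V"
proof -
  have "cfc (emb c) (\<lambda>t. max 0 (min 1 (2 * t - 1))) - of_real (max 0 (min 1 (2 * 1 - 1))) \<in> V"
  proof (rule cfc_in_closed_subspace)
    show "star (emb c) = emb c"
      using positives_star[OF c] by (simp flip: emb_star)
    show "continuous_on UNIV (\<lambda>t::real. max 0 (min 1 (2 * t - 1)))"
      by (intro continuous_intros)
  qed (use V in auto)
  then show ?thesis
    by (simp add: emb_plateau[OF c])
qed

lemma mult_plateau:
  assumes c: "c \<in> positives" and a: "a = a * c"
  shows "a * plateau c = a"
proof -
  have "emb (plateau c) - 1 \<in> {v. emb a * v = 0}"
  proof (rule plateau_in_closed_subspace[OF c])
    show "closed {v. emb a * v = 0}"
      by (intro closed_Collect_eq continuous_intros)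
    show "emb c - 1 \<in> {v. emb a * v = 0}"
      using a by (simp add: algebra_simps flip: emb_simps)
  qed (simp_all add: algebra_simps flip: mult.assoc)
  then have "emb (a * plateau c) = emb a"
    by (simp add: algebra_simps emb_simps)
  then show ?thesis
    by simp
qed

text \<open>The subspace consists of the elements of the unitization that multiply \<open>A\<close>
  into the ideal; it contains \<open>emb c - 1\<close>.\<close>

lemma plateau_unit_mod_ideal:
  assumes I: "closed_ideal I" and c: "c \<in> positives" and unit: "\<And>x. c * x - x \<in> I"
  shows "plateau c * x - x \<in> I"
proof -
  have "norm (act z x) \<le> norm z * norm x" for z x
  proof -
    have "onorm (act z) * norm x \<le> norm z * norm x"
      by (rule mult_right_mono) (simp_all add: norm_unitization_def)
    then show ?thesis
      using onorm[OF bounded_linear_act, of z x] by linarith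
  qed
  then have bl: "bounded_linear (\<lambda>z. act z x)" for x
    by (intro bounded_linear_intro[of _ "norm x"]) (simp_all add: act_simps)
  define V where "V = {v. \<forall>x. act v x \<in> I}"
  have "emb (plateau c) - 1 \<in> V"
  proof (rule plateau_in_closed_subspace[OF c])
    have "V = (\<Inter>x. (\<lambda>v. act v x) -` I)"
      by (auto simp: V_def)
    moreover have "closed ((\<lambda>v. act v x) -` I)" for x
      by (intro closed_vimage ideal_closed[OF I] bounded_linear.continuous_on[OF bl]
          continuous_on_id)
    ultimately show "closed V"
      by auto
    show "emb c - 1 \<in> V"
      using unit by (simp add: V_def act_def scaleC_minus_left)
  qed (auto simp: V_def act_simps ideal_zero[OF I] ideal_add[OF I] ideal_scaleR[OF I])
  then have "act (emb (plateau c) - 1) x \<in> I"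
    by (simp add: V_def)
  then show ?thesis
    by (simp add: act_def scaleC_minus_left)
qed

lemma positives_with_local_unitE:
  assumes "a \<in> positives_with_local_unit"
  obtains a' where "a' \<in> positives_with_local_unit" "a * a' = a" "a' * a = a"
    "star a = a" "star a' = a'"
proof -
  obtain c where c: "a \<in> positives" "c \<in> positives" "a = a * c"
    using assms by (auto simp: positives_with_local_unit_def)
  note p = plateau_local_unit[OF c(2)]
  then have "star (plateau c) = plateau c"
    by (auto simp: positives_with_local_unit_def intro: positives_star)
  moreover note positives_star[OF c(1)] mult_plateau[OF c(2,3)]
  moreover have "plateau c * a = star (a * plateau c)"
    by (simp only: star_mult calculation(1,2))
  ultimately show ?thesis
    using that[OF p] by metis
qed

section \<open>Cuntz comparison in the corner\<close>

lemma stab_mult_corner: "stab_mult (corner a) (corner b) = corner (a * b)"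
proof -
  have "(\<Sum>k. corner a i k * corner b k j) = corner (a * b) i j" for i j
    by (subst suminf_finite[of "{0}"]) (auto simp: corner_def)
  then show ?thesis
    by (simp add: stab_mult_def)
qed

lemma stab_star_corner: "stab_star (corner a) = corner (star a)"
  by (auto simp: stab_star_def corner_def fun_eq_iff)

lemma stab_add_corner: "stab_add (corner a) (corner b) = corner (a + b)"
  by (auto simp: stab_add_def corner_def fun_eq_iff)

lemma corner_zero: "corner 0 = stab_zero"
  by (auto simp: stab_zero_def corner_def fun_eq_iff)

lemma corner_norm_zero: "corner_norm n (\<lambda>i j. 0 :: 'a::cstar_algebra) = 0"
  using corner_norm_least[of 0 "\<lambda>i j. 0 :: 'a" n] corner_norm_nonneg[of n "\<lambda>i j. 0 :: 'a"]
  by (simp add: mat_bound_def)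

lemma corner_stabilization: "corner a \<in> stabilization"
  unfolding stabilization_def
proof (intro CollectI allI impI exI[of _ 1])
  fix e :: real and m n :: nat
  assume "e > 0" "1 \<le> m" "1 \<le> n"
  then have "(\<lambda>i j. truncate m (corner a) i j - truncate n (corner a) i j) = (\<lambda>i j. 0)"
    by (auto simp: truncate_def corner_def fun_eq_iff)
  then show "corner_norm (max m n) (\<lambda>i j. truncate m (corner a) i j - truncate n (corner a) i j) < e"
    using \<open>e > 0\<close> by (simp add: corner_norm_zero)
qed

lemma corner_stab_positives:
  assumes "a \<in> positives"
  shows "corner a \<in> stab_positives"
proof -
  obtain x where "a = star x * x"
    using assms by (auto simp: positives_def)
  then have "corner a = stab_mult (stab_star (corner x)) (corner x)"
    by (simp add: stab_star_corner stab_mult_corner)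
  then show ?thesis
    unfolding stab_positives_def using corner_stabilization by blast
qed

lemma cuntz_below_corner:
  assumes "a = r * b * star r"
  shows "cuntz_below (corner a) (corner b)"
proof -
  have "stab_diff (corner a) (stab_mult (stab_mult (corner r) (corner b)) (stab_star (corner r)))
      = (\<lambda>i j. 0)"
    by (simp add: stab_mult_corner stab_star_corner stab_diff_def assms)
  then show ?thesis
    unfolding cuntz_below_def
    by (intro exI[of _ "\<lambda>_. corner r"]) (simp add: corner_stabilization stab_norm_def corner_norm_zero)
qed

text \<open>Also the source of reflexivity: for \<open>b = a\<close> the conjugating element is a
  local unit of \<open>a\<close>.\<close>

lemma corner_in_cuntz_class:
  assumes "a \<in> positives" "b \<in> positives" "a = r * b * star r" "b = t * a * star t"
  shows "corner b \<in> cuntz_class (corner a)"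
  by (simp add: cuntz_class_def cuntz_rel_def corner_stab_positives[OF assms(1)]
      corner_stab_positives[OF assms(2)] cuntz_below_corner[OF assms(3)] cuntz_below_corner[OF assms(4)])

lemma in_cuntz_multiple_Suc:
  assumes "P \<in> X" "Q \<in> cuntz_multiple n X" "stab_mult P Q = stab_zero"
    and "R \<in> cuntz_class (stab_add P Q)"
  shows "R \<in> cuntz_multiple (n + 1) X"
  using assms by (auto simp: cuntz_add_def)

lemma corner_in_cuntz_multiple_one:
  assumes X: "corner b \<in> X" and b: "corner b \<in> cuntz_class (corner b)"
  shows "corner b \<in> cuntz_multiple 1 X"
proof -
  have "stab_zero \<in> cuntz_class (stab_zero :: 'a inf_matrix)"
    using corner_in_cuntz_class[of "0::'a" 0 0 0]
    by (simp add: corner_zero positives_iff emb_simps)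
  moreover have "stab_mult (corner b) stab_zero = stab_zero" "stab_add (corner b) stab_zero = corner b"
    by (simp_all add: stab_mult_corner stab_add_corner flip: corner_zero)
  ultimately show ?thesis
    using X b by (auto simp: cuntz_add_def intro!: bexI[of _ "corner b"])
qed

section \<open>The Hjelmborg-Rordam property gives property (S)\<close>

lemma conj_positives:
  assumes "a \<in> positives"
  shows "y * a * star y \<in> positives"
proof -
  obtain p where "a = star p * p"
    using assms by (auto simp: positives_def)
  then have "y * a * star y = star (p * star y) * (p * star y)"
    by (simp add: star_mult star_star mult.assoc)
  then show ?thesis
    unfolding positives_def by blast
qed

text \<open>The C*-identity strips a factor off the orthogonality relation. Consequently everything
  that has \<open>star y * y\<close> as a local unit annihilates \<open>y\<close>.\<close>

lemma mult_eq_zero_of_orthogonal_range: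
  fixes y :: "'a::cstar_algebra"
  assumes "star y * y * (y * star y) = 0"
  shows "star y * y * y = 0" "star y * (star y * y) = 0"
proof -
  have "star (star y * (star y * y)) * (star y * (star y * y)) =
      star y * y * (y * star y) * (star y * y)"
    by (simp add: star_mult star_star mult.assoc)
  then show "star y * (star y * y) = 0"
    unfolding assms by (simp add: star_mult_self_eq_zero_iff)
  then have "star (star y * (star y * y)) = 0"
    by simp
  then show "star y * y * y = 0"
    by (simp add: star_mult star_star mult.assoc)
qed

text \<open>The second copy is \<open>z s z\<^sup>*\<close> with \<open>z\<^sup>* z\<close> a local unit of \<open>s\<close>, rather than one obtained from \<open>s\<close>
  itself. This keeps all comparisons exact: the sequences in \<open>cuntz_below\<close> are constant.\<close>

lemma hjelmborg_rordam_property_S: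
  assumes HR: "hjelmborg_rordam TYPE('a::cstar_algebra)"
  shows "property_S TYPE('a)"
  unfolding property_S_def
proof
  fix a :: 'a
  assume a: "a \<in> positives_with_local_unit"
  have transfer: "\<exists>y. a' = star y * y \<and> a' * (y * star y) = 0"
    if "a' \<in> positives_with_local_unit" for a' :: 'a
    using HR that unfolding hjelmborg_rordam_def by blast
  have a_pos: "a \<in> positives"
    using a by (simp add: positives_with_local_unit_def)
  obtain a' where a': "a' \<in> positives_with_local_unit" "a * a' = a" "a' * a = a"
      "star a = a" "star a' = a'"
    using positives_with_local_unitE[OF a] .
  obtain y where y: "a' = star y * y" "a' * (y * star y) = 0"
    using transfer[OF a'(1)] by blast
  note a'y = mult_eq_zero_of_orthogonal_range[of y, folded y(1), OF y(2)]
  have ay: "a * y = 0" "star y * a = 0"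
    using a'y a'(2,3) by (metis mult.assoc mult_zero_right, metis mult.assoc mult_zero_left)
  define b1 where "b1 = y * a * star y"
  have b1_pos: "b1 \<in> positives"
    unfolding b1_def by (rule conj_positives[OF a_pos])
  have ya: "star y * (y * z) = a' * z" for z
    by (simp add: y(1) mult.assoc)
  have aa': "a * (a' * z) = a * z" "a' * (a * z) = a * z" for z
    using a'(2,3) by (metis mult.assoc)+
  have ab1: "a * b1 = 0"
    using ay(1) by (simp add: b1_def flip: mult.assoc)
  define s where "s = a + b1"
  have s_pos: "s \<in> positives"
    unfolding s_def by (rule positives_add[OF a_pos b1_pos])
  \<comment> \<open>The local units of the two summands add up; the cross terms vanish by
    \<open>a * y = 0\<close> and \<open>star y * a' = 0\<close>.\<close>
  have "s * (a' + y * star y) = s"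
  proof -
    have "a * (y * star y) = 0" "b1 * a' = 0"
      using ay(1) a'y(2) by (simp_all add: b1_def mult.assoc flip: mult.assoc[of a y])
    moreover have "b1 * (y * star y) = b1"
      by (simp add: b1_def mult.assoc ya aa')
    ultimately show ?thesis
      by (simp add: s_def algebra_simps a'(2))
  qed
  moreover have "a' + y * star y \<in> positives"
  proof (rule positives_add)
    show "y * star y \<in> positives"
      unfolding positives_def using star_star[of y] by (metis (mono_tags, lifting) mem_Collect_eq)
  qed (use a'(1) in \<open>simp add: positives_with_local_unit_def\<close>)
  ultimately have "s \<in> positives_with_local_unit"
    using s_pos unfolding positives_with_local_unit_def by (metis (mono_tags, lifting) mem_Collect_eq)
  then obtain s' where s': "s' \<in> positives_with_local_unit" "s * s' = s" "s' * s = s"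
      "star s = s" "star s' = s'"
    by (rule positives_with_local_unitE)
  obtain z where z: "s' = star z * z" "s' * (z * star z) = 0"
    using transfer[OF s'(1)] by blast
  note s'z = mult_eq_zero_of_orthogonal_range[of z, folded z(1), OF z(2)]
  define b where "b = z * s * star z"
  have b_pos: "b \<in> positives"
    unfolding b_def by (rule conj_positives[OF s_pos])
  have sz: "s * z = 0"
    using s'z(1) s'(2) by (metis mult.assoc mult_zero_right)
  \<comment> \<open>From \<open>s * z = 0\<close> to \<open>a * z = 0\<close>: multiplying by
    \<open>a\<close> removes the summand \<open>b1\<close>, and the C*-identity removes the extra
    factor \<open>a\<close>.\<close>
  have "a * (s * z) = a * a * z"
    by (simp add: s_def ab1 algebra_simps flip: mult.assoc)
  then have "star (a * z) * (a * z) = 0"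
    by (simp add: sz star_mult a'(4) mult.assoc)
  then have "a * z = 0"
    by (simp add: star_mult_self_eq_zero_iff)
  then have ab: "a * b = 0"
    by (simp add: b_def flip: mult.assoc)
  have zz: "star z * (z * w) = s' * w" for w
    by (simp add: z(1) mult.assoc)
  have ss': "s * (s' * w) = s * w" "s' * (s * w) = s * w" for w
    using s'(2,3) by (metis mult.assoc)+
  \<comment> \<open>Conjugations by \<open>y\<close> and \<open>star y\<close> carry
    \<open>a\<close> to \<open>b1\<close> and back because \<open>star y * y = a'\<close>, and
    \<open>y * star y\<close> is a local unit of \<open>b1\<close>. The same holds for
    \<open>z\<close>, \<open>s\<close> and \<open>b\<close>.\<close>
  have eq_a: "a = a' * a * star a'" "a = star y * b1 * star (star y)"
    by (simp_all add: a' b1_def star_star mult.assoc ya aa' flip: y(1))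
  have eq_b1: "b1 = (y * star y) * b1 * star (y * star y)"
    by (simp add: b1_def star_mult star_star mult.assoc ya aa')
  have eq_s: "s = s' * s * star s'" "s = star z * b * star (star z)"
    by (simp_all add: s' b_def star_star mult.assoc zz ss' flip: z(1))
  have eq_b: "b = (z * star z) * b * star (z * star z)"
    by (simp add: b_def star_mult star_star mult.assoc zz ss')
  have "corner b1 \<in> cuntz_multiple 1 (cuntz_class (corner a))"
    by (intro corner_in_cuntz_multiple_one
        corner_in_cuntz_class[OF a_pos b1_pos eq_a(2) b1_def]
        corner_in_cuntz_class[OF b1_pos b1_pos eq_b1 eq_b1])
  moreover have "corner a \<in> cuntz_class (corner a)"
    by (rule corner_in_cuntz_class[OF a_pos a_pos eq_a(1) eq_a(1)])
  moreover have "corner s \<in> cuntz_class (stab_add (corner a) (corner b1))"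
    unfolding stab_add_corner s_def[symmetric]
    by (rule corner_in_cuntz_class[OF s_pos s_pos eq_s(1) eq_s(1)])
  moreover have "stab_mult (corner a) (corner b1) = stab_zero"
    by (simp add: stab_mult_corner ab1 corner_zero)
  ultimately have "corner s \<in> cuntz_multiple (1 + 1) (cuntz_class (corner a))"
    by (intro in_cuntz_multiple_Suc)
  moreover have "corner b \<in> cuntz_multiple 1 (cuntz_class (corner b))"
    by (intro corner_in_cuntz_multiple_one corner_in_cuntz_class[OF b_pos b_pos eq_b eq_b])
  moreover have "cuntz_below (corner s) (corner b)"
    by (rule cuntz_below_corner[OF eq_s(2)])
  \<comment> \<open>The witness is \<open>n = 1\<close>: a representative of \<open>2[a]\<close>
    lies below one of \<open>[b]\<close>.\<close>
  ultimately have "cuntz_stably_below (cuntz_class (corner a)) (cuntz_class (corner b))"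
    unfolding cuntz_stably_below_def cuntz_le_def by blast
  then show "\<exists>b\<in>positives. a * b = 0 \<and>
      cuntz_stably_below (cuntz_class (corner a)) (cuntz_class (corner b))"
    using ab b_pos by blast
qed

section \<open>Property (S) gives softness\<close>

lemma cuntz_class_memD:
  assumes "P \<in> cuntz_class Q"
  shows "P \<in> stab_positives" "Q \<in> stab_positives" "cuntz_below P Q" "cuntz_below Q P"
  using assms by (auto simp: cuntz_class_def cuntz_rel_def)

lemma cuntz_multiple_stab_positives: "P \<in> cuntz_multiple n X \<Longrightarrow> P \<in> stab_positives"
  by (cases n) (auto simp: cuntz_add_def dest: cuntz_class_memD)

lemma cuntz_multiple_ideal:
  assumes I: "closed_ideal I" and b: "b \<in> I" and P: "P \<in> cuntz_multiple n (cuntz_class (corner b))"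
  shows "P i j \<in> I"
  using P
proof (induction n arbitrary: P i j)
  case 0
  then show ?case
    using cuntz_below_ideal[OF I, of P stab_zero] cuntz_class_memD[of P stab_zero]
    by (simp add: stab_zero_def ideal_zero[OF I])
next
  case (Suc n)
  then obtain Q R where Q: "Q \<in> cuntz_class (corner b)"
    and R: "R \<in> cuntz_multiple n (cuntz_class (corner b))" and P: "P \<in> cuntz_class (stab_add Q R)"
    by (auto simp: cuntz_add_def)
  have "corner b i j \<in> I" for i j
    by (simp add: corner_def b ideal_zero[OF I])
  then have "Q i j \<in> I" for i j
    by (intro cuntz_below_ideal[OF I cuntz_class_memD(1,2)[OF Q]] cuntz_class_memD(3)[OF Q])
  then have "stab_add Q R i j \<in> I" for i j
    by (simp add: stab_add_def ideal_add[OF I] Suc.IH[OF R])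
  then show ?case
    by (intro cuntz_below_ideal[OF I cuntz_class_memD(1,2)[OF P]] cuntz_class_memD(3)[OF P])
qed

text \<open>As \<open>n + 1\<close> is at least 1, \<open>P\<close> is equivalent to a sum with a
  summand \<open>R\<close> equivalent to \<open>corner a\<close>. Membership of the entries in the
  ideal passes from \<open>Q\<close> to \<open>P\<close>, to the sum, to \<open>R\<close> and
  finally to \<open>corner a\<close>.\<close>

lemma cuntz_stably_below_ideal:
  assumes I: "closed_ideal I" and b: "b \<in> I"
    and below: "cuntz_stably_below (cuntz_class (corner a)) (cuntz_class (corner b))"
  shows "a \<in> I"
proof -
  obtain n P Q where P: "P \<in> cuntz_multiple (Suc n) (cuntz_class (corner a))"
    and Q: "Q \<in> cuntz_multiple n (cuntz_class (corner b))" and PQ: "cuntz_below P Q"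
    using below by (auto simp: cuntz_stably_below_def cuntz_le_def)
  have P_I: "P i j \<in> I" for i j
    by (rule cuntz_below_ideal[OF I cuntz_multiple_stab_positives[OF P]
          cuntz_multiple_stab_positives[OF Q] cuntz_multiple_ideal[OF I b Q] PQ])
  obtain R S where R: "R \<in> cuntz_class (corner a)"
    and S: "S \<in> cuntz_multiple n (cuntz_class (corner a))" and RS: "P \<in> cuntz_class (stab_add R S)"
    using P by (auto simp: cuntz_add_def)
  have "stab_add R S i j \<in> I" for i j
    by (rule cuntz_below_ideal[OF I cuntz_class_memD(2,1)[OF RS] P_I cuntz_class_memD(4)[OF RS]])
  then have "R i i + S i i \<in> I" for i
    by (simp add: stab_add_def)
  then have "R i j \<in> I" for i j
    by (rule stab_positives_summand_ideal[OF I cuntz_class_memD(1)[OF R]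
          cuntz_multiple_stab_positives[OF S]])
  then have "corner a 0 0 \<in> I"
    by (rule cuntz_below_ideal[OF I cuntz_class_memD(2,1)[OF R] _ cuntz_class_memD(4)[OF R]])
  then show ?thesis
    by (simp add: corner_def)
qed

lemma quotient_unitalE:
  assumes I: "closed_ideal I" and "quotient_unital I"
  obtains e where "\<And>x. e * x - x \<in> I" "\<And>x. x * e - x \<in> I"
proof -
  obtain E where E: "E \<in> quotient_carrier I"
    "\<And>X. X \<in> quotient_carrier I \<Longrightarrow> quotient_mult I E X = X \<and> quotient_mult I X E = X"
    using assms(2) by (auto simp: quotient_unital_def)
  obtain e where e: "E = ideal_rel I `` {e}"
    using E(1) by (auto simp: quotient_carrier_def quotient_def)
  have "e * x - x \<in> I \<and> x * e - x \<in> I" for x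
  proof -
    define X where "X = ideal_rel I `` {x}"
    have X: "X \<in> quotient_carrier I"
      by (auto simp: quotient_carrier_def quotient_def X_def)
    have refl: "y \<in> ideal_rel I `` {y}" for y
      by (simp add: ideal_rel_def ideal_zero[OF I])
    then have "e * x \<in> quotient_mult I E X" "x * e \<in> quotient_mult I X E"
      unfolding quotient_mult_def e X_def by blast+
    then have "e * x \<in> X" "x * e \<in> X"
      using E(2)[OF X] by auto
    then have "x - e * x \<in> I" "x - x * e \<in> I"
      by (auto simp: X_def ideal_rel_def)
    then show ?thesis
      using ideal_minus[OF I] by (metis minus_diff_eq)
  qed
  then show ?thesis
    using that by blast
qed

lemma property_S_soft:
  assumes S: "property_S TYPE('a::cstar_algebra)"
  shows "soft TYPE('a)"
  unfolding soft_def
proof (intro allI impI notI)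
  fix I :: "'a set"
  assume "closed_ideal I \<and> I \<noteq> UNIV" and unital: "quotient_unital I"
  then have I: "closed_ideal I" and proper: "I \<noteq> UNIV"
    by auto
  obtain e where e: "\<And>x. e * x - x \<in> I" "\<And>x. x * e - x \<in> I"
    by (rule quotient_unitalE[OF I unital]) blast
  \<comment> \<open>The lift \<open>e\<close> need not be positive. Since closed ideals are
    self-adjoint, \<open>star e\<close> is a unit modulo \<open>I\<close> as well, and so is the
    positive element \<open>star e * e\<close>.\<close>
  define c where "c = star e * e"
  have c: "c \<in> positives"
    by (auto simp: c_def positives_def)
  have "c * x - x \<in> I" for x
  proof -
    have "star (star x * e - star x) \<in> I"
      by (intro ideal_star[OF I] e)
    then have "star e * x - x \<in> I"
      by (simp add: star_diff star_mult star_star)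
    moreover have "star e * (e * x - x) \<in> I"
      by (intro ideal_mult_left[OF I] e)
    ultimately have "star e * (e * x - x) + (star e * x - x) \<in> I"
      by (intro ideal_add[OF I])
    then show ?thesis
      by (simp add: c_def algebra_simps)
  qed
  note a = plateau_unit_mod_ideal[OF I c this]
  obtain b where b: "plateau c * b = 0"
    "cuntz_stably_below (cuntz_class (corner (plateau c))) (cuntz_class (corner b))"
    using S plateau_local_unit[OF c] by (auto simp: property_S_def)
  have "b \<in> I"
    using ideal_minus[OF I a[of b]] by (simp add: b(1))
  then have "plateau c \<in> I"
    by (rule cuntz_stably_below_ideal[OF I _ b(2)])
  then have "x \<in> I" for x
    using ideal_diff[OF I ideal_mult_right[OF I] a[of x], of "plateau c" x] by simp
  then show False
    using proper by blast
qed

theorem proposition2p14: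
  shows "(hjelmborg_rordam TYPE('a::cstar_algebra) \<longrightarrow> property_S TYPE('a)) \<and>
         (property_S TYPE('a) \<longrightarrow> soft TYPE('a))"
  using hjelmborg_rordam_property_S property_S_soft by blast

end
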